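(* Let $P(\lambda)\in\mathbb F[\lambda]^{m\times n}$ be a matrix polynomial of grade $d$, and let $\ell<d$ (with $\ell$ a positive integer). Let $K_1(\lambda)\in\mathbb F[\lambda]^{m_1\times(n+m_1)}$ and $N_1(\lambda)\in\mathbb F[\lambda]^{n\times(n+m_1)}$ be a pair of dual minimal bases, and let $K_2(\lambda)\in\mathbb F[\lambda]^{m_2\times(m+m_2)}$ and $N_2(\lambda)\in\mathbb F[\lambda]^{m\times(m+m_2)}$ be another pair of dual minimal bases, such that all the row degrees of $K_1(\lambda)$ and of $K_2(\lambda)$ are equal to $\ell$, all the row degrees of $N_1(\lambda)$ are equal to $\epsilon$, and all the row degrees of $N_2(\lambda)$ are equal to $\eta$, with $\epsilon+\eta=d-\ell$ and with $\epsilon$ and $\eta$ both nonzero. Consider the equation $$N_2(\lambda)M(\lambda)N_1(\lambda)^T=P(\lambda).\qquad(\ast)$$ Then the following statements hold. (a) The equation $(\ast)$ for the unknown matrix polynomial $M(\lambda)$ of grade $\ell$ has infinitely many solutions. When $\deg(P(\lambda))=d$, all of such solutions have degree equal to $\ell$. (b) The set of solutions of $(\ast)$ depends on $m_2n(\epsilon+1)+(m_2+m)m_1$ free parameters. (c) Let $\Psi^\dagger_{(N_1,N_2)}:=(\cdot)^T\circ\Phi_{N_1}^\dagger\circ(\cdot)^T\circ\Phi_{N_2}^\dagger$. Then, any solution of $(\ast)$ can be written as $$M(\lambda)=\Psi^\dagger_{(N_1,N_2)}[P](\lambda)+\Phi_{N_1}^\dagger[X^TK_2](\lambda)^T+Y^TK_1(\lambda),$$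 for some $Y\in\mathbb F^{m_1\times(m_2+m)}$ and $X(\lambda)\in\mathbb F_\epsilon[\lambda]^{m_2\times n}$.
   Context: $\mathbb F$ is an arbitrary field. $\mathbb F_k[\lambda]^{p\times q}$ is the vector space of $p\times q$ matrix polynomials of grade $k$, i.e. of the form $\sum_{i=0}^kP_i\lambda^i$ with any coefficient possibly zero; the degree is the largest $i$ with $P_i\ne 0$. A minimal basis of a subspace of $\mathbb F(\lambda)^q$ is a basis of vector polynomials whose sum of degrees is least among all bases consisting of vector polynomials. A $p\times q$ matrix polynomial ($p<q$) is called a minimal basis if its rows form a minimal basis of the rational subspace they span. Row degrees are the degrees of the rows. $K(\lambda)\in\mathbb F[\lambda]^{p_1\times q}$ and $N(\lambda)\in\mathbb F[\lambda]^{p_2\times q}$ are dual minimal bases if $p_1+p_2=q$, $K(\lambda)N(\lambda)^T=0$, and both are minimal bases; the row degrees of $K(\lambda)$ are then the right minimal indices of $N(\lambda)$. Convolution matrices: for $Q(\lambda)=\sum_{i=0}^qQ_i\lambda^i$ of grade $q$ and $j\ge0$, $C_j(Q)$ is the block Toeplitz matrix with $j+1$ block columns and $q+j+1$ block rows whose $c$-th block column ($c=1,\dots,j+1$) has $Q_q,Q_{q-1},\dots,Q_0$ in block rows $c,c+1,\dots,c+q$ and zeros elsewhere. In particular, $C_0(Q)$ is the block column with blocks $Q_q,\dots,Q_0$ from top to bottom. Minimum norm solution operators: let $N(\lambda)\in\mathbb F[\lambda]^{t\times(s+t)}$ be a minimal basis with all its row degrees equal to $\nu$ and all its right minimal indices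 equal to $\kappa$, and let $b\ge\kappa$. For $R(\lambda)\in\mathbb F_{\nu+b}[\lambda]^{t\times r}$, $\Phi_N^\dagger[R](\lambda)=B(\lambda)\in\mathbb F_b[\lambda]^{(s+t)\times r}$ is the matrix polynomial whose coefficients are defined by $C_0(B)=C_b(N)^\dagger C_0(R)$, where $A^\dagger$ denotes the Moore–Penrose pseudoinverse of a matrix $A$; it is called the minimum norm solution of $N(\lambda)B(\lambda)=R(\lambda)$. Here $\Phi_{N_2}^\dagger$ is applied to polynomials of grade $d$ with $b=\ell+\epsilon$, and $\Phi_{N_1}^\dagger$ is applied to polynomials of grade $\ell+\epsilon$ with $b=\ell$ (in particular, $X^TK_2$ is $X(\lambda)^TK_2(\lambda)$, of grade $\ell+\epsilon$). $(\cdot)^T$ denotes the transpose operation and $g\circ f$ the composition of $g$ with $f$.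
   Formalization: Solutions always exist, but "infinitely many" is claimed only for infinite F (over a finite field the set is finite); (c) is claimed when the pseudoinverses of C_ℓ(N_1) and C_{ℓ+ε}(N_2) exist, for the adjoint given by any field involution, as over some fields they do not exist. *)

theory Defs
  imports
    "Jordan_Normal_Form.VS_Connect"
    "Jordan_Normal_Form.Gauss_Jordan_Elimination"
    "HOL-Computational_Algebra.Polynomial_Factorial"
    Complex_Main
begin

section \<open>Matrix polynomials\<close>

text \<open>A matrix polynomial is a matrix with polynomial entries. The coefficient of
  \<open>\<lambda>^i\<close> is a constant matrix.\<close>

definition coeff_mat :: "'a::zero poly mat \<Rightarrow> nat \<Rightarrow> 'a mat" where
  "coeff_mat P i = map_mat (\<lambda>p. coeff p i) P"

definition const_poly_mat :: "'a::zero mat \<Rightarrow> 'a poly mat" where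
  "const_poly_mat A = map_mat (\<lambda>a. [:a:]) A"

text \<open>The set of \<open>p \<times> q\<close> matrix polynomials of grade \<open>k\<close>.\<close>

definition graded :: "nat \<Rightarrow> nat \<Rightarrow> nat \<Rightarrow> 'a::zero poly mat set" where
  "graded k p q = {P \<in> carrier_mat p q. \<forall>i>k. coeff_mat P i = 0\<^sub>m p q}"

text \<open>The supremum of the empty set of naturals is 0, so the zero polynomial gets degree 0.\<close>

definition mat_deg :: "'a::zero poly mat \<Rightarrow> nat" where
  "mat_deg P = Sup {i. coeff_mat P i \<noteq> 0\<^sub>m (dim_row P) (dim_col P)}"

definition vec_deg :: "'a::zero poly vec \<Rightarrow> nat" where
  "vec_deg v = Sup {i. map_vec (\<lambda>p. coeff p i) v \<noteq> 0\<^sub>v (dim_vec v)}"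


section \<open>Minimal bases\<close>

text \<open>Linear independence and span are taken in the vector space \<open>F(\<lambda>)^q\<close> over the field
  \<open>F(\<lambda>)\<close> of fractions of polynomials.\<close>

abbreviation rat_vec :: "'a::field poly vec \<Rightarrow> 'a poly fract vec" where
  "rat_vec v \<equiv> map_vec to_fract v"

definition rat_span :: "nat \<Rightarrow> 'a::field poly vec set \<Rightarrow> 'a poly fract vec set" where
  "rat_span q B =
     LinearCombinations.module.span class_ring (module_vec TYPE('a poly fract) q) (rat_vec ` B)"

definition rat_indep :: "nat \<Rightarrow> 'a::field poly vec set \<Rightarrow> bool" where
  "rat_indep q B \<longleftrightarrow>
     \<not> LinearCombinations.module.lin_dep class_ring (module_vec TYPE('a poly fract) q) (rat_vec ` B)"

text \<open>\<open>B\<close> is a basis, consisting of vector polynomials, of the subspace \<open>W\<close> of \<open>F(\<lambda>)^q\<close>.\<close>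

definition poly_basis_of ::
    "nat \<Rightarrow> 'a::field poly fract vec set \<Rightarrow> 'a poly vec set \<Rightarrow> bool" where
  "poly_basis_of q W B \<longleftrightarrow> B \<subseteq> carrier_vec q \<and> rat_indep q B \<and> rat_span q B = W"

definition minimal_basis_of ::
    "nat \<Rightarrow> 'a::field poly fract vec set \<Rightarrow> 'a poly vec set \<Rightarrow> bool" where
  "minimal_basis_of q W B \<longleftrightarrow> poly_basis_of q W B \<and>
     (\<forall>B'. poly_basis_of q W B' \<longrightarrow> sum vec_deg B \<le> sum vec_deg B')"

text \<open>The rows of a matrix form a family, not a set, hence the requirement that they be
  distinct.\<close>

definition minimal_basis :: "nat \<Rightarrow> nat \<Rightarrow> 'a::field poly mat \<Rightarrow> bool" where
  "minimal_basis p q K \<longleftrightarrow> K \<in> carrier_mat p q \<and> p < q \<and> distinct (rows K) \<and>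
     minimal_basis_of q (rat_span q (set (rows K))) (set (rows K))"

definition dual_minimal_bases ::
    "nat \<Rightarrow> nat \<Rightarrow> nat \<Rightarrow> 'a::field poly mat \<Rightarrow> 'a poly mat \<Rightarrow> bool" where
  "dual_minimal_bases p1 p2 q K N \<longleftrightarrow> p1 + p2 = q \<and> minimal_basis p1 q K \<and>
     minimal_basis p2 q N \<and> K * N\<^sup>T = 0\<^sub>m p1 p2"

definition row_degrees_eq :: "'a::zero poly mat \<Rightarrow> nat \<Rightarrow> bool" where
  "row_degrees_eq K k \<longleftrightarrow> (\<forall>i<dim_row K. vec_deg (row K i) = k)"


section \<open>Convolution matrices\<close>

text \<open>\<open>conv_mat g j Q\<close> is \<open>C_j(Q)\<close> for \<open>Q\<close> of grade \<open>g\<close>. With block rows and block columns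
  counted from 0, the block in position \<open>(a, b)\<close> is \<open>Q_{g + b - a}\<close> for \<open>b \<le> a \<le> b + g\<close>, and
  zero otherwise.\<close>

definition conv_mat :: "nat \<Rightarrow> nat \<Rightarrow> 'a::zero poly mat \<Rightarrow> 'a mat" where
  "conv_mat g j Q =
     mat ((g + j + 1) * dim_row Q) ((j + 1) * dim_col Q)
       (\<lambda>(r, c).
          let a = r div dim_row Q; b = c div dim_col Q
          in if b \<le> a \<and> a \<le> b + g
             then coeff_mat Q (g + b - a) $$ (r mod dim_row Q, c mod dim_col Q)
             else 0)"


section \<open>Moore--Penrose inverse\<close>

text \<open>The Penrose equations need an adjoint, that is, an involutive automorphism \<open>\<sigma>\<close> of
  the field: \<open>cnj\<close> for the complex numbers, the identity for the real numbers. The adjoint of a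
  matrix is its \<open>\<sigma>\<close>-conjugate transpose.\<close>

definition field_involution :: "('a::field \<Rightarrow> 'a) \<Rightarrow> bool" where
  "field_involution \<sigma> \<longleftrightarrow> (\<forall>x y. \<sigma> (x + y) = \<sigma> x + \<sigma> y) \<and> (\<forall>x y. \<sigma> (x * y) = \<sigma> x * \<sigma> y) \<and>
     (\<forall>x. \<sigma> (\<sigma> x) = x)"

definition adj :: "('a \<Rightarrow> 'a) \<Rightarrow> 'a mat \<Rightarrow> 'a mat" where
  "adj \<sigma> A = map_mat \<sigma> (A\<^sup>T)"

definition is_mp_inverse :: "('a::field \<Rightarrow> 'a) \<Rightarrow> 'a mat \<Rightarrow> 'a mat \<Rightarrow> bool" where
  "is_mp_inverse \<sigma> A X \<longleftrightarrow> X \<in> carrier_mat (dim_col A) (dim_row A) \<and>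
     A * X * A = A \<and> X * A * X = X \<and> adj \<sigma> (A * X) = A * X \<and> adj \<sigma> (X * A) = X * A"

text \<open>Over a general field with involution a matrix need not have a Moore--Penrose inverse. It
  has at most one, and it always has one if \<open>\<sigma>\<close> is anisotropic, in particular over the real and
  the complex numbers; see the last section.\<close>

definition mp_inverse :: "('a::field \<Rightarrow> 'a) \<Rightarrow> 'a mat \<Rightarrow> 'a mat" where
  "mp_inverse \<sigma> A = (THE X. is_mp_inverse \<sigma> A X)"


section \<open>Minimum norm solution operators\<close>

text \<open>\<open>min_norm_sol \<sigma> \<nu> b N\<close> is the operator \<open>\<Phi>_N^\<dagger>\<close>, with \<open>N\<close> regarded as a matrix polynomial
  of grade \<open>\<nu>\<close>. It maps matrix polynomials of grade \<open>\<nu> + b\<close> to matrix polynomials of grade \<open>b\<close>;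
  an element of the latter is determined by its convolution matrix \<open>C_0\<close>.\<close>

definition min_norm_sol ::
    "('a::field \<Rightarrow> 'a) \<Rightarrow> nat \<Rightarrow> nat \<Rightarrow> 'a poly mat \<Rightarrow> 'a poly mat \<Rightarrow> 'a poly mat" where
  "min_norm_sol \<sigma> \<nu> b N R = (THE B. B \<in> graded b (dim_col N) (dim_col R) \<and>
     conv_mat b 0 B = mp_inverse \<sigma> (conv_mat \<nu> b N) * conv_mat (\<nu> + b) 0 R)"


section \<open>Free parameters\<close>

text \<open>A set \<open>S\<close> of \<open>p \<times> q\<close> matrix polynomials depends on \<open>k\<close> free parameters if there is an
  affine map \<open>c \<mapsto> M0 + c_0 V_0 + \<dots> + c_{k-1} V_{k-1}\<close> from \<open>F^k\<close> that is a bijection onto \<open>S\<close>; in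
  other words, if \<open>S\<close> is an affine space of dimension \<open>k\<close> over \<open>F\<close>.\<close>

definition depends_on_free_parameters ::
    "nat \<Rightarrow> nat \<Rightarrow> 'a::field poly mat set \<Rightarrow> nat \<Rightarrow> bool" where
  "depends_on_free_parameters p q S k \<longleftrightarrow>
     (\<exists>M0 \<in> carrier_mat p q. \<exists>V. (\<forall>t<k. V t \<in> carrier_mat p q) \<and>
        bij_betw
          (\<lambda>c :: 'a vec. mat p q (\<lambda>(i, j). M0 $$ (i, j) + (\<Sum>t<k. Polynomial.smult (c $ t) (V t $$ (i, j)))))
          (carrier_vec k) S)"


section \<open>Existence and uniqueness of the Moore--Penrose inverse\<close>

lemma field_involution_hom:
  assumes "field_involution \<sigma>"
  shows "\<sigma> 0 = 0" "\<sigma> (sum f A) = (\<Sum>x\<in>A. \<sigma> (f x))"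
proof -
  have add: "\<And>x y. \<sigma> (x + y) = \<sigma> x + \<sigma> y"
    using assms by (simp add: field_involution_def)
  show z: "\<sigma> 0 = 0" using add[of 0 0] by (metis add_0 add_cancel_right_right)
  show "\<sigma> (sum f A) = (\<Sum>x\<in>A. \<sigma> (f x))"
    by (induction A rule: infinite_finite_induct) (auto simp: z add)
qed

definition anisotropic :: "('a::field \<Rightarrow> 'a) \<Rightarrow> bool" where
  "anisotropic \<sigma> \<longleftrightarrow> (\<forall>n. \<forall>v \<in> carrier_vec n. (\<Sum>i<n. \<sigma> (v $ i) * v $ i) = 0 \<longrightarrow> v = 0\<^sub>v n)"

lemma anisotropicD:
  assumes "anisotropic \<sigma>" "v \<in> carrier_vec n" "(\<Sum>i<n. \<sigma> (v $ i) * v $ i) = 0"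
  shows "v = 0\<^sub>v n"
  by (rule assms(1)[unfolded anisotropic_def, THEN spec, THEN bspec, THEN mp, OF assms(2,3)])

lemma adj_dim [simp]: "dim_row (adj \<sigma> A) = dim_col A" "dim_col (adj \<sigma> A) = dim_row A"
  by (auto simp: adj_def)

lemma adj_adj:
  assumes "field_involution \<sigma>"
  shows "adj \<sigma> (adj \<sigma> A) = A"
  using assms by (intro eq_matI) (auto simp: adj_def field_involution_def)

lemma adj_mult:
  assumes "field_involution \<sigma>" "dim_col A = dim_row B"
  shows "adj \<sigma> (A * B) = adj \<sigma> B * adj \<sigma> A"
proof (rule eq_matI)
  fix i j assume "i < dim_row (adj \<sigma> B * adj \<sigma> A)" "j < dim_col (adj \<sigma> B * adj \<sigma> A)"
  moreover have "\<And>x y. \<sigma> (x * y) = \<sigma> x * \<sigma> y" using assms by (simp add: field_involution_def)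
  ultimately show "adj \<sigma> (A * B) $$ (i, j) = (adj \<sigma> B * adj \<sigma> A) $$ (i, j)"
    using assms
    by (auto simp: adj_def scalar_prod_def field_involution_hom(2)
        mult.commute intro!: sum.cong)
qed (use assms in \<open>auto simp: adj_def\<close>)

lemma mat_assoc:
  fixes A B C :: "'a::semiring_0 mat"
  assumes "dim_col A = dim_row B" "dim_col B = dim_row C"
  shows "A * B * C = A * (B * C)"
  using assms by (intro assoc_mult_mat[of _ "dim_row A" "dim_col A" _ "dim_col B" _ "dim_col C"]) auto

lemma is_mp_inverse_unique:
  assumes \<sigma>: "field_involution \<sigma>" and X: "is_mp_inverse \<sigma> A X" and Y: "is_mp_inverse \<sigma> A Y"
  shows "X = Y"
proof -
  have d: "dim_row X = dim_col A" "dim_col X = dim_row A" "dim_row Y = dim_col A" "dim_col Y = dim_row A"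
    using X Y by (auto simp: is_mp_inverse_def)
  have x: "A * X * A = A" "X * A * X = X" "adj \<sigma> (A * X) = A * X" "adj \<sigma> (X * A) = X * A"
    and y: "A * Y * A = A" "Y * A * Y = Y" "adj \<sigma> (A * Y) = A * Y" "adj \<sigma> (Y * A) = Y * A"
    using X Y by (auto simp: is_mp_inverse_def)
  have AXY: "A * X = A * Y"
  proof -
    have "A * X = A * Y * A * X" by (simp add: y(1))
    also have "\<dots> = (A * Y) * (A * X)" by (rule mat_assoc) (simp_all add: d)
    finally have "adj \<sigma> (A * X) = adj \<sigma> ((A * Y) * (A * X))" by (rule arg_cong)
    also have "\<dots> = (A * X) * (A * Y)" by (subst adj_mult[OF \<sigma>]) (simp_all add: d x y)
    also have "\<dots> = A * X * A * Y" by (rule mat_assoc[symmetric]) (simp_all add: d)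
    also have "\<dots> = A * Y" by (simp add: x(1))
    finally show ?thesis by (simp add: x(3))
  qed
  have XAY: "X * A = Y * A"
  proof -
    have "X * A = X * (A * Y * A)" by (simp add: y(1))
    also have "\<dots> = (X * A) * (Y * A)" by (simp add: d mat_assoc)
    finally have "adj \<sigma> (X * A) = adj \<sigma> ((X * A) * (Y * A))" by (rule arg_cong)
    also have "\<dots> = (Y * A) * (X * A)" by (subst adj_mult[OF \<sigma>]) (simp_all add: d x y)
    also have "\<dots> = Y * (A * X * A)" by (simp add: d mat_assoc)
    also have "\<dots> = Y * A" by (simp add: x(1))
    finally show ?thesis by (simp add: x(4))
  qed
  have "X = Y * A * X" using x(2) XAY by simp
  also have "\<dots> = Y * (A * X)" by (rule mat_assoc) (simp_all add: d)
  also have "\<dots> = Y * A * Y" unfolding AXY by (rule mat_assoc[symmetric]) (simp_all add: d)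
  finally show ?thesis using y(2) by simp
qed

lemma mp_inverse_eq:
  assumes "field_involution \<sigma>" "is_mp_inverse \<sigma> A X"
  shows "mp_inverse \<sigma> A = X"
  unfolding mp_inverse_def using assms is_mp_inverse_unique by blast

lemma generalized_inverse_exists:
  fixes A :: "'a::field mat"
  assumes A: "A \<in> carrier_mat n m"
  shows "\<exists>G \<in> carrier_mat m n. A * G * A = A"
proof -
  obtain R Z where gj: "gauss_jordan A (0\<^sub>m n 0) = (R, Z)" by fastforce
  obtain P Q where PQ: "P \<in> carrier_mat n n" "Q \<in> carrier_mat n n" "Q * P = 1\<^sub>m n" "R = P * A"
    using gauss_jordan_transform[OF A zero_carrier_mat gj, of undefined] by (auto simp: Units_def ring_mat_def)
  have R: "R \<in> carrier_mat n m" using PQ A by auto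
  obtain f where f: "pivot_fun R f m"
    using gauss_jordan_row_echelon[OF A gj] R by (auto simp: row_echelon_form_def)
  have dR: "dim_row R = n" using R by auto
  note p = pivot_funD[OF dR f]
  define H where "H = mat m n (\<lambda>(j, i). if j = f i then 1 else 0 :: 'a)"
  have H: "H \<in> carrier_mat m n" by (simp add: H_def)
  have RH: "(R * H) $$ (i, k) = (if i = k \<and> f i < m then 1 else 0)" if "i < n" "k < n" for i k
  proof -
    have "(R * H) $$ (i, k) = (\<Sum>j = 0..<m. R $$ (i, j) * (if j = f k then 1 else 0))"
      using that R by (simp add: H_def scalar_prod_def)
    also have "\<dots> = (if f k < m then R $$ (i, f k) else 0)"
      by (simp add: if_distrib[of "(*) _"] cong: if_cong)
    finally show ?thesis using p(4)[of k] p(5)[of k i] that by auto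
  qed
  have RHR: "R * H * R = R"
  proof (rule eq_matI)
    fix i j assume ij: "i < dim_row R" "j < dim_col R"
    have RH_dim: "dim_row (R * H) = n" "dim_col (R * H) = n" using R H by auto
    have "(R * H * R) $$ (i, j) = row (R * H) i \<bullet> col R j"
      using ij RH_dim R by (intro index_mult_mat) auto
    also have "\<dots> = (\<Sum>k = 0..<n. row (R * H) i $ k * col R j $ k)"
      using R by (simp add: scalar_prod_def)
    also have "\<dots> = (\<Sum>k = 0..<n. if k = i then (if f i < m then R $$ (i, j) else 0) else 0)"
    proof (rule sum.cong)
      fix k assume k: "k \<in> {0..<n}"
      have "row (R * H) i $ k = (R * H) $$ (i, k)"
        using ij k RH_dim dR by (intro index_row) auto
      also have "\<dots> = (if i = k \<and> f i < m then 1 else 0)" using ij k dR by (intro RH) auto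
      finally have "row (R * H) i $ k = (if i = k \<and> f i < m then 1 else 0)" .
      moreover have "col R j $ k = R $$ (k, j)" using ij k dR by (intro index_col) auto
      ultimately show "row (R * H) i $ k * col R j $ k =
          (if k = i then (if f i < m then R $$ (i, j) else 0) else 0)" by simp
    qed simp
    also have "\<dots> = (if f i < m then R $$ (i, j) else 0)" using ij R by simp
    also have "\<dots> = R $$ (i, j)" using p(1)[of i] p(2)[of i j] ij R by force
    finally show "(R * H * R) $$ (i, j) = R $$ (i, j)" .
  qed (use R H in auto)
  have "Q * R = Q * P * A" unfolding PQ(4) by (rule mat_assoc[symmetric]) (use PQ A in auto)
  then have A_eq: "Q * R = A" unfolding PQ(3) using A by simp
  have "A * (H * P) * A = Q * R * (H * P) * A" by (simp only: A_eq)
  also have "\<dots> = Q * (R * H * (P * A))"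
    using carrier_matD[OF PQ(1)] carrier_matD[OF PQ(2)] carrier_matD[OF A] carrier_matD[OF R]
      carrier_matD[OF H] by (simp add: mat_assoc)
  also have "\<dots> = A" unfolding PQ(4)[symmetric] RHR by (rule A_eq)
  finally show ?thesis using H PQ by (intro bexI[of _ "H * P"]) auto
qed

lemma anisotropic_mat_eq_0:
  fixes D :: "'a::field mat"
  assumes an: "anisotropic \<sigma>" and D: "D \<in> carrier_mat n m" and z: "adj \<sigma> D * D = 0\<^sub>m m m"
  shows "D = 0\<^sub>m n m"
proof (rule eq_matI)
  have dD: "dim_row D = n" "dim_col D = m" using D by (rule carrier_matD)+
  fix i j assume "i < dim_row (0\<^sub>m n m :: 'a mat)" "j < dim_col (0\<^sub>m n m :: 'a mat)"
  then have ij: "i < n" "j < m" by simp_all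
  have "(adj \<sigma> D * D) $$ (j, j) = row (adj \<sigma> D) j \<bullet> col D j"
    by (rule index_mult_mat(1)) (simp_all add: dD ij)
  also have "\<dots> = (\<Sum>i<n. \<sigma> (col D j $ i) * col D j $ i)"
    unfolding scalar_prod_def dim_col dD atLeast0LessThan
  proof (rule sum.cong[OF refl])
    fix k assume "k \<in> {..<n}"
    then show "row (adj \<sigma> D) j $ k * col D j $ k = \<sigma> (col D j $ k) * col D j $ k"
      using ij dD by (simp add: adj_def)
  qed
  finally have "(\<Sum>i<n. \<sigma> (col D j $ i) * col D j $ i) = (adj \<sigma> D * D) $$ (j, j)" by (rule sym)
  also have "\<dots> = 0" unfolding z using ij by (simp del: index_mult_mat)
  finally have "col D j = 0\<^sub>v n"
    by (rule anisotropicD[OF an, rotated]) (rule carrier_vecI, simp add: dD)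
  then have "col D j $ i = 0" using ij by simp
  then show "D $$ (i, j) = 0\<^sub>m n m $$ (i, j)" using ij dD by simp
qed (use D in simp_all)

lemma gram_cancel:
  assumes \<sigma>: "field_involution \<sigma>"
    and an: "anisotropic \<sigma>"
    and U: "dim_row U = dim_col A" "dim_row V = dim_col A" "dim_col V = dim_col U"
    and eq: "adj \<sigma> A * (A * U) = adj \<sigma> A * (A * V)"
  shows "A * U = A * V"
proof -
  define n m k where "n = dim_row A" and "m = dim_col A" and "k = dim_col U"
  have A: "A \<in> carrier_mat n m" and aA: "adj \<sigma> A \<in> carrier_mat m n"
    and UV: "U \<in> carrier_mat m k" "V \<in> carrier_mat m k"
    using U by (auto simp: n_def m_def k_def)
  define D where "D = A * (U - V)"
  have D': "D = A * U - A * V" unfolding D_def by (rule mult_minus_distrib_mat[OF A UV])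
  have D: "D \<in> carrier_mat n k" using A UV by (auto simp: D')
  have AU: "A * U \<in> carrier_mat n k" "A * V \<in> carrier_mat n k" using A UV by auto
  have "adj \<sigma> A * D = adj \<sigma> A * (A * U) - adj \<sigma> A * (A * V)"
    unfolding D' by (rule mult_minus_distrib_mat[OF aA AU])
  also have "\<dots> = 0\<^sub>m m k" unfolding eq by (rule minus_r_inv_mat[OF mult_carrier_mat[OF aA AU(2)]])
  finally have AD: "adj \<sigma> A * D = 0\<^sub>m m k" .
  have "adj \<sigma> D * D = adj \<sigma> (U - V) * adj \<sigma> A * D"
    unfolding D_def using U by (subst adj_mult[OF \<sigma>]) simp_all
  also have "\<dots> = adj \<sigma> (U - V) * (adj \<sigma> A * D)"
    using U by (intro mat_assoc) (simp_all add: D_def)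
  also have "\<dots> = 0\<^sub>m k k" unfolding AD
  proof (rule right_mult_zero_mat)
    show "adj \<sigma> (U - V) \<in> carrier_mat k m" using UV by (intro carrier_matI) auto
  qed
  finally have "D = 0\<^sub>m n k" using anisotropic_mat_eq_0[OF an D] by blast
  then have "A * U - A * V = 0\<^sub>m n k" by (simp add: D')
  show ?thesis
  proof (rule eq_matI)
    fix i j assume ij: "i < dim_row (A * V)" "j < dim_col (A * V)"
    have "(A * U - A * V) $$ (i, j) = 0"
      unfolding \<open>A * U - A * V = 0\<^sub>m n k\<close> using ij A UV by simp
    moreover have "(A * U - A * V) $$ (i, j) = (A * U) $$ (i, j) - (A * V) $$ (i, j)"
      using ij by (intro index_minus_mat) simp_all
    ultimately show "(A * U) $$ (i, j) = (A * V) $$ (i, j)" by simp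
  qed (use U in simp_all)
qed

lemma hermitian_right_inverse_exists:
  assumes \<sigma>: "field_involution \<sigma>"
    and an: "anisotropic \<sigma>"
  shows "\<exists>X. dim_row X = dim_col A \<and> dim_col X = dim_row A \<and> A * X * A = A \<and> adj \<sigma> (A * X) = A * X"
proof -
  define B where "B = adj \<sigma> A * A"
  have dB: "dim_row B = dim_col A" "dim_col B = dim_col A" by (simp_all add: B_def)
  have "B \<in> carrier_mat (dim_col A) (dim_col A)" using dB by auto
  from generalized_inverse_exists[OF this]
  obtain G where "G \<in> carrier_mat (dim_col A) (dim_col A)" and BGB: "B * G * B = B" by blast
  then have dG: "dim_row G = dim_col A" "dim_col G = dim_col A" by auto
  define X where "X = G * adj \<sigma> A"
  have dX: "dim_row X = dim_col A" "dim_col X = dim_row A" by (simp_all add: X_def dG)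
  have "adj \<sigma> A * (A * (G * B)) = B * G * B"
    by (simp add: B_def dG mat_assoc)
  also have "\<dots> = adj \<sigma> A * (A * 1\<^sub>m (dim_col A))" by (simp add: BGB) (simp add: B_def)
  finally have "A * (G * B) = A * 1\<^sub>m (dim_col A)"
    by (rule gram_cancel[OF \<sigma> an, rotated -1]) (simp_all add: dG dB)
  then have AXA: "A * X * A = A" by (simp add: X_def B_def dG mat_assoc)
  have "adj \<sigma> A * adj \<sigma> (A * X) = adj \<sigma> (A * X * A)"
    by (rule adj_mult[OF \<sigma>, symmetric]) (simp add: dX)
  then have 1: "adj \<sigma> A * adj \<sigma> (A * X) = adj \<sigma> A" by (simp add: AXA)
  have "A * X * adj \<sigma> (A * X) = A * (X * adj \<sigma> (A * X))" by (rule mat_assoc) (simp_all add: dX)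
  also have "X * adj \<sigma> (A * X) = G * (adj \<sigma> A * adj \<sigma> (A * X))"
    unfolding X_def[THEN arg_cong[of _ _ "\<lambda>Z. Z * adj \<sigma> (A * X)"]] by (rule mat_assoc) (simp_all add: dG dX)
  also have "\<dots> = X" unfolding 1 by (simp add: X_def)
  finally have 2: "A * X * adj \<sigma> (A * X) = A * X" .
  have "adj \<sigma> (A * X * adj \<sigma> (A * X)) = A * X * adj \<sigma> (A * X)"
    by (subst adj_mult[OF \<sigma>]) (simp_all add: adj_adj[OF \<sigma>])
  then have "adj \<sigma> (A * X) = A * X" by (simp only: 2)
  then show ?thesis using dX AXA by blast
qed

lemma mp_inverse_exists:
  assumes \<sigma>: "field_involution \<sigma>"
    and an: "anisotropic \<sigma>"
  shows "\<exists>X. is_mp_inverse \<sigma> A X"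
proof -
  obtain X where dX: "dim_row X = dim_col A" "dim_col X = dim_row A"
      and X: "A * X * A = A" "adj \<sigma> (A * X) = A * X"
    using hermitian_right_inverse_exists[OF \<sigma> an, of A] by blast
  obtain W where dW: "dim_row W = dim_row A" "dim_col W = dim_col A"
      and W: "adj \<sigma> A * W * adj \<sigma> A = adj \<sigma> A" "adj \<sigma> (adj \<sigma> A * W) = adj \<sigma> A * W"
    using hermitian_right_inverse_exists[OF \<sigma> an, of "adj \<sigma> A"] by auto
  define Y where "Y = adj \<sigma> W"
  have dY: "dim_row Y = dim_col A" "dim_col Y = dim_row A" by (simp_all add: Y_def dW)
  have "adj \<sigma> (adj \<sigma> A * W) = Y * A"
    by (subst adj_mult[OF \<sigma>]) (simp_all add: Y_def dW adj_adj[OF \<sigma>])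
  then have YA: "Y * A = adj \<sigma> A * W" by (simp add: W(2))
  have aYA: "adj \<sigma> (Y * A) = Y * A" by (simp add: YA W(2))
  have "adj \<sigma> (adj \<sigma> A * W * adj \<sigma> A) = A * (Y * A)"
    by (subst adj_mult[OF \<sigma>]) (simp_all add: dW adj_adj[OF \<sigma>] YA W(2))
  then have AYA: "A * (Y * A) = A" by (simp add: W(1) adj_adj[OF \<sigma>])
  define Z where "Z = Y * A * X"
  have dZ: "dim_row Z = dim_col A" "dim_col Z = dim_row A" by (simp_all add: Z_def dX dY)
  have "A * Z = A * (Y * A) * X" by (simp add: Z_def dX dY mat_assoc)
  then have AZ: "A * Z = A * X" by (simp only: AYA)
  have "Z * A = Y * (A * X * A)" by (simp add: Z_def dX dY mat_assoc)
  then have ZA: "Z * A = Y * A" by (simp only: X(1))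
  have "Z * A * Z = Y * (A * Z)" unfolding ZA by (simp add: dY dZ mat_assoc)
  also have "\<dots> = Z" unfolding AZ by (simp add: Z_def dX dY mat_assoc)
  finally have "Z * A * Z = Z" .
  moreover have "Z \<in> carrier_mat (dim_col A) (dim_row A)" using dZ by auto
  ultimately have "is_mp_inverse \<sigma> A Z"
    by (simp add: is_mp_inverse_def AZ ZA aYA X)
  then show ?thesis ..
qed

corollary mp_inverse_real:
  fixes A :: "real mat"
  shows "field_involution (\<lambda>x::real. x)" "is_mp_inverse (\<lambda>x. x) A (mp_inverse (\<lambda>x. x) A)"
proof -
  show f: "field_involution (\<lambda>x::real. x)" by (simp add: field_involution_def)
  have an: "anisotropic (\<lambda>x::real. x)"
    by (auto simp: anisotropic_def sum_nonneg_eq_0_iff intro!: eq_vecI)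
  show "is_mp_inverse (\<lambda>x. x) A (mp_inverse (\<lambda>x. x) A)"
    using mp_inverse_exists[OF f an, of A] mp_inverse_eq[OF f, of A] by auto
qed

corollary mp_inverse_complex:
  fixes A :: "complex mat"
  shows "field_involution cnj" "is_mp_inverse cnj A (mp_inverse cnj A)"
proof -
  show f: "field_involution cnj" by (simp add: field_involution_def)
  have "v = 0\<^sub>v n" if v: "v \<in> carrier_vec n" "(\<Sum>i<n. cnj (v $ i) * v $ i) = 0" for n v
  proof -
    have "complex_of_real (\<Sum>i<n. (cmod (v $ i))\<^sup>2) = (\<Sum>i<n. cnj (v $ i) * v $ i)"
      by (simp add: complex_norm_square mult.commute flip: of_real_power)
    then have "(\<Sum>i<n. (cmod (v $ i))\<^sup>2) = 0" using v(2) by (metis of_real_eq_0_iff)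
    then show ?thesis using v(1) by (auto simp: sum_nonneg_eq_0_iff intro!: eq_vecI)
  qed
  then have an: "anisotropic cnj" by (auto simp: anisotropic_def)
  show "is_mp_inverse cnj A (mp_inverse cnj A)"
    using mp_inverse_exists[OF f an, of A] mp_inverse_eq[OF f, of A] by auto
qed

end

theory Submission
  imports Defs
begin

text \<open>For dual minimal bases \<open>K\<close> (\<open>s \<times> q\<close>, row degrees \<open>\<kappa>\<close>) and \<open>N\<close> (\<open>t \<times> q\<close>, row degrees
  \<open>\<nu>\<close>), everything rests on the sequence of spaces of graded polynomial matrices
  \<open>X \<mapsto> K\<^sup>T X\<close>, \<open>B \<mapsto> N B\<close>, from grade \<open>b - \<kappa>\<close> through grade \<open>b\<close> to grade \<open>\<nu> + b\<close>, being short exact for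
  \<open>b \<ge> \<kappa>\<close>.

  Exactness in the middle (\<open>kernel_of_dual\<close>) uses minimality only through one consequence: a
  polynomial vector of degree less than \<open>\<kappa>\<close> in the rational row space of \<open>K\<close> is zero, since
  exchanging it for a row would give a cheaper basis (\<open>minimal_basis_no_low_degree\<close>). If a
  polynomial vector is a combination of the rows with rational coefficients of common denominator
  \<open>g\<close>, dividing the numerators by \<open>g\<close> leaves a combination of the remainders that is \<open>g\<close> times a
  vector of degree less than \<open>\<kappa>\<close>; so the coefficients are polynomials. In the same way a
  cancellation among leading coefficients would produce a vector of degree less than \<open>\<kappa>\<close>, so
  degrees add up.

  Surjectivity (\<open>conv_mat_right_inverse\<close>) is a dimension count. Exactness in the middle gives
  \<open>(b + 1) q \<le> (\<nu> + b + 1) t + (b - \<kappa> + 1) s\<close>, that is, \<open>\<kappa> s \<le> \<nu> t\<close>. As \<open>K\<close> and \<open>N\<close> play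
  symmetric roles, \<open>\<kappa> s = \<nu> t\<close>; hence the count is an equality, and the convolution matrix
  \<open>C_b(N)\<close> has full row rank.

  The equation \<open>N2 M N1\<^sup>T = P\<close> then splits into \<open>N2 Z = P\<close> and \<open>M N1\<^sup>T = Z\<close>, both solvable in the
  required grades, and the solutions of the two homogeneous equations are \<open>K2\<^sup>T X\<close> and \<open>Y\<^sup>T K1\<close>
  with unique \<open>X\<close> of grade \<open>\<epsilon>\<close> and constant \<open>Y\<close>. This works for any choice of right inverses of
  the convolution matrices, so it yields the parameter count over every field; with Moore--Penrose
  inverses it yields the representation by minimum norm solutions. A solution of degree less than
  \<open>l\<close> would force \<open>P\<close> to have degree less than \<open>d\<close>.\<close>

section \<open>Linear algebra over a field\<close>

text \<open>Some \<open>u\<close> has a nonzero coefficient in \<open>w\<close>, so it can be recovered from \<open>w\<close> and the other basis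
  vectors.\<close>

lemma (in vec_space) exchange_basis:
  assumes S: "finite S" "S \<subseteq> carrier_vec n" "lin_indpt S"
    and w: "w \<in> span S" "w \<noteq> 0\<^sub>v n"
  shows "\<exists>u\<in>S. lin_indpt (insert w (S - {u})) \<and> span (insert w (S - {u})) = span S"
proof -
  have wc: "w \<in> carrier_vec n" using w S span_is_subset2 by blast
  obtain a where a: "w = lincomb a S"
    using w finite_in_span[OF S(1)] S(2) by auto
  have "\<exists>u\<in>S. a u \<noteq> 0"
  proof (rule ccontr)
    assume "\<not> ?thesis"
    then have "lincomb a S = 0\<^sub>v n"
      using S by (intro eq_vecI) (auto simp: lincomb_index lincomb_dim)
    then show False using a w by simp
  qed
  then obtain u where u: "u \<in> S" "a u \<noteq> 0" by blast
  define E where "E = S - {u}"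
  have E: "finite E" "E \<subseteq> carrier_vec n" "u \<notin> E" "insert u E = S" "u \<in> carrier_vec n"
    using S u by (auto simp: E_def)
  have EwC: "insert w E \<subseteq> carrier_vec n" using E wc by auto
  have "lin_indpt E" using S(3) E(4) subset_li_is_li by blast
  have uE: "u \<notin> span E" using lindep_span[of S] S u by (auto simp: E_def)
  have lE: "lincomb a E \<in> span E" using E(1) by (auto simp: span_def)
  then have lEc: "lincomb a E \<in> carrier_vec n" using E(2) span_is_subset2 by blast
  have weq: "w = a u \<cdot>\<^sub>v u + lincomb a E"
    unfolding a E(4)[symmetric]
    by (subst lincomb_insert2) (use E in auto)
  have u_eq: "u = inverse (a u) \<cdot>\<^sub>v (w + (-1) \<cdot>\<^sub>v lincomb a E)"
  proof (rule eq_vecI)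
    fix i assume "i < dim_vec (inverse (a u) \<cdot>\<^sub>v (w + (-1) \<cdot>\<^sub>v lincomb a E))"
    then have "i < n" using lEc by simp
    then show "u $ i = (inverse (a u) \<cdot>\<^sub>v (w + (-1) \<cdot>\<^sub>v lincomb a E)) $ i"
      using lEc E(5) u(2) by (simp add: weq)
  qed (use lEc E(5) in auto)
  have lE': "lincomb a E \<in> span (insert w E)"
    using lE span_is_monotone[of E "insert w E"] by blast
  have u_in: "u \<in> span (insert w E)"
    unfolding u_eq[THEN arg_cong[of _ _ "\<lambda>x. x \<in> span (insert w E)"]]
    by (intro smult_in_span[OF EwC] span_add1[OF EwC] lE')
      (use in_own_span[of "insert w E"] EwC in auto)
  have span1: "span S \<subseteq> span (insert w E)"
  proof (rule span_subsetI[OF EwC])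
    show "S \<subseteq> span (insert w E)"
      using u_in in_own_span[of "insert w E"] EwC E(4) by auto
  qed
  have span2: "span (insert w E) \<subseteq> span S"
  proof (rule span_subsetI[OF S(2)])
    show "insert w E \<subseteq> span S" using w(1) in_own_span[of S] S(2) E(4) by auto
  qed
  have "w \<notin> span E"
  proof
    assume "w \<in> span E"
    then have "insert w E \<subseteq> span E" using in_own_span[of E] E(2) by auto
    then have "span (insert w E) \<subseteq> span E" by (rule span_subsetI[OF E(2)])
    then show False using u_in uE by blast
  qed
  moreover have "w \<notin> E" using \<open>w \<notin> span E\<close> in_own_span[of E] E(2) by auto
  ultimately have "lin_indpt (insert w E)"
    using lin_dep_iff_in_span[of E w] \<open>lin_indpt E\<close> E(2) wc by auto
  then show ?thesis using u(1) span1 span2 by (auto simp: E_def)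
qed

lemma (in vec_space) mat_of_cols_mult_in_span:
  assumes "set ws \<subseteq> carrier_vec n" "z \<in> carrier_vec (length ws)"
  shows "mat_of_cols n ws *\<^sub>v z \<in> span (set ws)"
proof -
  have "vec (length ws) (\<lambda>i. z $ i) = z" using assms(2) by auto
  then have "mat_of_cols n ws *\<^sub>v z = lincomb_list (\<lambda>i. z $ i) ws"
    using assms(1) by (subst lincomb_list_as_mat_mult) auto
  then show ?thesis unfolding span_list_as_span[OF assms(1), symmetric] span_list_def by blast
qed

lemma (in vec_space) lin_indpt_mat_of_cols_mult:
  assumes ws: "set ws \<subseteq> carrier_vec n" "distinct ws" "lin_indpt (set ws)"
    and z: "z \<in> carrier_vec (length ws)" "mat_of_cols n ws *\<^sub>v z = 0\<^sub>v n"
  shows "z = 0\<^sub>v (length ws)"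
proof -
  define f where "f v = z $ (THE i. i < length ws \<and> ws ! i = v)" for v
  have f: "f (ws ! i) = z $ i" if "i < length ws" for i
  proof -
    have "(THE j. j < length ws \<and> ws ! j = ws ! i) = i"
      using that ws(2) by (intro the_equality) (auto simp: nth_eq_iff_index_eq)
    then show ?thesis by (simp add: f_def)
  qed
  have "vec (length ws) (\<lambda>i. f (ws ! i)) = z" using z(1) f by (intro eq_vecI) auto
  then have "lincomb_list (\<lambda>i. f (ws ! i)) ws = 0\<^sub>v n"
    using ws(1) z(2) by (subst lincomb_list_as_mat_mult) auto
  then have "lincomb f (set ws) = 0\<^sub>v n"
    by (simp add: lincomb_as_lincomb_list_distinct[OF ws(1,2)])
  from not_lindepD[OF ws(3) _ _ _ this] have "f \<in> set ws \<rightarrow> {0}" by auto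
  then have "z $ i = 0" if "i < length ws" for i 
    using f[OF that] nth_mem[OF that] \<open>f \<in> set ws \<rightarrow> {0}\<close> by (simp add: Pi_iff)
  then show ?thesis using z(1) by (intro eq_vecI) auto
qed

lemma four_block_mat_eq_iff:
  assumes "A \<in> carrier_mat r1 c1" "B \<in> carrier_mat r1 c2" "C \<in> carrier_mat r2 c1" "D \<in> carrier_mat r2 c2"
    and "A' \<in> carrier_mat r1 c1" "B' \<in> carrier_mat r1 c2" "C' \<in> carrier_mat r2 c1" "D' \<in> carrier_mat r2 c2"
  shows "four_block_mat A B C D = four_block_mat A' B' C' D' \<longleftrightarrow> A = A' \<and> B = B' \<and> C = C' \<and> D = D'"
proof
  assume eq: "four_block_mat A B C D = four_block_mat A' B' C' D'"
  have ix: "four_block_mat A B C D $$ (i, j) = four_block_mat A' B' C' D' $$ (i, j)" for i j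
    by (simp only: eq)
  have "A $$ (i, j) = A' $$ (i, j)" if "i < r1" "j < c1" for i j
    using ix[of i j] assms that by auto
  moreover have "B $$ (i, j) = B' $$ (i, j)" if "i < r1" "j < c2" for i j
    using ix[of i "j + c1"] assms that by auto
  moreover have "C $$ (i, j) = C' $$ (i, j)" if "i < r2" "j < c1" for i j
    using ix[of "i + r1" j] assms that by auto
  moreover have "D $$ (i, j) = D' $$ (i, j)" if "i < r2" "j < c2" for i j
    using ix[of "i + r1" "j + c1"] assms that by auto
  ultimately show "A = A' \<and> B = B' \<and> C = C' \<and> D = D'"
    using assms by (auto intro!: eq_matI)
qed auto

text \<open>The matrices \<open>[U1 U2]\<close> and \<open>[V1; V2]\<close> are square, so each one-sided inverse is two-sided. This
  replaces rank-nullity arguments: it is used over \<open>F(\<lambda>)\<close> to see that \<open>K\<close> spans the whole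
  kernel of \<open>N\<close>, and over \<open>F\<close> to turn a dimension count into surjectivity.\<close>

lemma paired_factors_of_identity:
  fixes U1 :: "'a::field mat"
  assumes car: "U1 \<in> carrier_mat c a" "U2 \<in> carrier_mat c e" "V1 \<in> carrier_mat a c" "V2 \<in> carrier_mat e c"
    and c: "c = a + e"
  shows "U1 * V1 + U2 * V2 = 1\<^sub>m c \<longleftrightarrow>
    V1 * U1 = 1\<^sub>m a \<and> V1 * U2 = 0\<^sub>m a e \<and> V2 * U1 = 0\<^sub>m e a \<and> V2 * U2 = 1\<^sub>m e"
proof -
  define U where "U = four_block_mat U1 U2 (0\<^sub>m 0 a) (0\<^sub>m 0 e)"
  define V where "V = four_block_mat V1 (0\<^sub>m a 0) V2 (0\<^sub>m e 0)"
  have U: "U \<in> carrier_mat c c" and V: "V \<in> carrier_mat c c"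
    unfolding U_def V_def using car c
    by (auto intro: carrier_matI)
  have "U * V = four_block_mat (U1 * V1 + U2 * V2) (U1 * 0\<^sub>m a 0 + U2 * 0\<^sub>m e 0)
      (0\<^sub>m 0 a * V1 + 0\<^sub>m 0 e * V2) (0\<^sub>m 0 a * 0\<^sub>m a 0 + 0\<^sub>m 0 e * 0\<^sub>m e 0)"
    unfolding U_def V_def by (rule mult_four_block_mat) (use car in auto)
  also have "\<dots> = U1 * V1 + U2 * V2"
    by (intro eq_matI) (use car in auto)
  finally have UV: "U * V = U1 * V1 + U2 * V2" .
  have "V * U = four_block_mat (V1 * U1 + 0\<^sub>m a 0 * 0\<^sub>m 0 a) (V1 * U2 + 0\<^sub>m a 0 * 0\<^sub>m 0 e)
      (V2 * U1 + 0\<^sub>m e 0 * 0\<^sub>m 0 a) (V2 * U2 + 0\<^sub>m e 0 * 0\<^sub>m 0 e)"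
    unfolding U_def V_def by (rule mult_four_block_mat) (use car in auto)
  also have "\<dots> = four_block_mat (V1 * U1) (V1 * U2) (V2 * U1) (V2 * U2)"
  proof -
    have "V1 * U1 + 0\<^sub>m a 0 * 0\<^sub>m 0 a = V1 * U1" "V1 * U2 + 0\<^sub>m a 0 * 0\<^sub>m 0 e = V1 * U2"
      "V2 * U1 + 0\<^sub>m e 0 * 0\<^sub>m 0 a = V2 * U1" "V2 * U2 + 0\<^sub>m e 0 * 0\<^sub>m 0 e = V2 * U2"
      by (intro eq_matI; use car in \<open>auto simp: scalar_prod_def\<close>)+
    then show ?thesis by (simp only:)
  qed
  finally have VU: "V * U = four_block_mat (V1 * U1) (V1 * U2) (V2 * U1) (V2 * U2)" .
  have one: "1\<^sub>m c = four_block_mat (1\<^sub>m a) (0\<^sub>m a e) (0\<^sub>m e a) (1\<^sub>m e :: 'a mat)"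
    unfolding c by (rule four_block_one_mat[symmetric])
  have "V * U = 1\<^sub>m c \<longleftrightarrow>
      V1 * U1 = 1\<^sub>m a \<and> V1 * U2 = 0\<^sub>m a e \<and> V2 * U1 = 0\<^sub>m e a \<and> V2 * U2 = 1\<^sub>m e"
    unfolding VU one
    by (rule four_block_mat_eq_iff) (use car in auto)
  moreover have "V * U = 1\<^sub>m c \<longleftrightarrow> U * V = 1\<^sub>m c"
    using mat_mult_left_right_inverse[OF U V] mat_mult_left_right_inverse[OF V U] by blast
  ultimately show ?thesis by (simp add: UV)
qed

text \<open>A generalized inverse \<open>H\<close> has \<open>L (H L - 1) = 0\<close>, and \<open>L\<close> can be cancelled.\<close>

lemma left_inverse_exists:
  fixes L :: "'a::field mat"
  assumes L: "L \<in> carrier_mat q s"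
    and inj: "\<And>z. z \<in> carrier_vec s \<Longrightarrow> L *\<^sub>v z = 0\<^sub>v q \<Longrightarrow> z = 0\<^sub>v s"
  shows "\<exists>H \<in> carrier_mat s q. H * L = 1\<^sub>m s"
proof -
  obtain H where H: "H \<in> carrier_mat s q" and LHL: "L * H * L = L"
    using generalized_inverse_exists[OF L] by blast
  have HL: "H * L \<in> carrier_mat s s" using H L by simp
  define D where "D = H * L - 1\<^sub>m s"
  have D: "D \<in> carrier_mat s s" using HL unfolding D_def by (intro minus_carrier_mat) simp
  have "L * D = L * (H * L) - L * 1\<^sub>m s"
    unfolding D_def by (rule mult_minus_distrib_mat[OF L HL]) simp
  also have "L * (H * L) = L" using LHL assoc_mult_mat[OF L H L] by simp
  finally have LD: "L * D = 0\<^sub>m q s" using L by simp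
  have D0: "col D j = 0\<^sub>v s" if "j < s" for j
  proof (rule inj)
    have "L *\<^sub>v col D j = col (L * D) j" by (rule col_mult2[symmetric, OF L D that])
    also have "\<dots> = 0\<^sub>v q" unfolding LD using that by auto
    finally show "L *\<^sub>v col D j = 0\<^sub>v q" .
  qed (use D that in auto)
  have "H * L = 1\<^sub>m s"
  proof (rule eq_matI)
    fix i j assume "i < dim_row (1\<^sub>m s :: 'a mat)" "j < dim_col (1\<^sub>m s :: 'a mat)"
    then have ij: "i < s" "j < s" by auto
    have "col D j $ i = 0" using D0 ij by simp
    then have "D $$ (i, j) = 0" using D ij by simp
    moreover have "D $$ (i, j) = (H * L) $$ (i, j) - 1\<^sub>m s $$ (i, j)"
      unfolding D_def using ij by (intro index_minus_mat) auto
    ultimately show "(H * L) $$ (i, j) = 1\<^sub>m s $$ (i, j)" by simp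
  qed (use HL in auto)
  then show ?thesis using H by blast
qed

text \<open>If \<open>a + e\<close> were smaller than \<open>c\<close>, zero columns of \<open>U2\<close> and zero rows of \<open>V2\<close> could be added to
  reach a square factorization, and the product in the other order, also an identity matrix, would
  have a zero row.\<close>

lemma identity_factor_dimension:
  fixes U1 :: "'a::field mat"
  assumes car: "U1 \<in> carrier_mat c a" "U2 \<in> carrier_mat c e" "V1 \<in> carrier_mat a c" "V2 \<in> carrier_mat e c"
    and one: "U1 * V1 + U2 * V2 = 1\<^sub>m c"
  shows "c \<le> a + e"
proof (rule ccontr)
  assume "\<not> c \<le> a + e"
  then obtain f where f: "c = a + f" "e < f" by (metis add_less_cancel_left less_imp_add_positive not_le add_lessD1)
  define U where "U = mat c f (\<lambda>(i, j). if j < e then U2 $$ (i, j) else 0)"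
  define V where "V = mat f c (\<lambda>(i, j). if i < e then V2 $$ (i, j) else 0)"
  have UV: "U \<in> carrier_mat c f" "V \<in> carrier_mat f c" by (auto simp: U_def V_def)
  have "U * V = U2 * V2"
  proof (rule eq_matI)
    fix i j assume "i < dim_row (U2 * V2)" "j < dim_col (U2 * V2)"
    then have ij: "i < c" "j < c" using car by auto
    have "(U * V) $$ (i, j) = (\<Sum>k<f. if k < e then U2 $$ (i, k) * V2 $$ (k, j) else 0)"
      using ij by (auto simp: U_def V_def scalar_prod_def atLeast0LessThan intro!: sum.cong)
    also have "\<dots> = (\<Sum>k<e. U2 $$ (i, k) * V2 $$ (k, j))"
      using f(2) by (intro sum.mono_neutral_cong_right) auto
    also have "\<dots> = (U2 * V2) $$ (i, j)" using ij car by (simp add: scalar_prod_def atLeast0LessThan)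
    finally show "(U * V) $$ (i, j) = (U2 * V2) $$ (i, j)" .
  qed (use car UV in auto)
  then have "V * U = 1\<^sub>m f"
    using paired_factors_of_identity[OF car(1) UV(1) car(3) UV(2) f(1)] one by simp
  moreover have "(V * U) $$ (e, e) = 0"
    using f by (auto simp: U_def V_def scalar_prod_def)
  ultimately show False using f by simp
qed

lemma mat_add_left_cancel:
  fixes A B C :: "'a::ab_group_add mat"
  assumes "A \<in> carrier_mat p q" "B \<in> carrier_mat p q" "C \<in> carrier_mat p q" "A + B = A + C"
  shows "B = C"
proof (rule eq_matI)
  fix i j assume "i < dim_row C" "j < dim_col C"
  then show "B $$ (i, j) = C $$ (i, j)"
    using arg_cong[OF assms(4), of "\<lambda>M. M $$ (i, j)"] assms(1-3) by simp
qed (use assms in auto)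

lemma mat_add_diff_cancel:
  fixes A B :: "'a::ab_group_add mat"
  assumes "A \<in> carrier_mat p q" "B \<in> carrier_mat p q"
  shows "B + (A - B) = A"
  using assms by (intro eq_matI) auto

section \<open>Degrees and grades\<close>

lemma graded_iff:
  "P \<in> graded k p q \<longleftrightarrow> P \<in> carrier_mat p q \<and> (\<forall>i<p. \<forall>j<q. \<forall>e>k. coeff (P $$ (i, j)) e = 0)"
proof -
  have "coeff_mat P e = 0\<^sub>m p q \<longleftrightarrow> (\<forall>i<p. \<forall>j<q. coeff (P $$ (i, j)) e = 0)"
    if "P \<in> carrier_mat p q" for e
  proof -
    have dim: "dim_row (coeff_mat P e) = p" "dim_col (coeff_mat P e) = q"
      using that by (auto simp: coeff_mat_def)
    have ix: "coeff_mat P e $$ (i, j) = coeff (P $$ (i, j)) e" if "i < p" "j < q" for i j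
      using that \<open>P \<in> carrier_mat p q\<close> by (simp add: coeff_mat_def)
    show ?thesis unfolding mat_eq_iff dim using ix by auto
  qed
  then show ?thesis unfolding graded_def by auto
qed

lemma Sup_nat_le_iff:
  assumes "finite S"
  shows "Sup S \<le> (k::nat) \<longleftrightarrow> (\<forall>x\<in>S. x \<le> k)"
  using assms by (auto simp: Sup_nat_def)

lemma Sup_coeff_support_le_iff:
  assumes "finite I"
  shows "Sup {e. \<exists>i\<in>I. coeff (f i) e \<noteq> (0::'a::zero)} \<le> k \<longleftrightarrow> (\<forall>i\<in>I. \<forall>e>k. coeff (f i) e = 0)"
proof -
  have "finite {e. \<exists>i\<in>I. coeff (f i) e \<noteq> 0}"
  proof (rule finite_subset)
    show "{e. \<exists>i\<in>I. coeff (f i) e \<noteq> 0} \<subseteq> (\<Union>i\<in>I. {..degree (f i)})"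
      using le_degree by fastforce
  qed (use assms in auto)
  from Sup_nat_le_iff[OF this, of k] show ?thesis
    unfolding not_le[symmetric] by blast
qed

lemma vec_deg_le_iff:
  "vec_deg v \<le> k \<longleftrightarrow> (\<forall>i<dim_vec v. \<forall>e>k. coeff (v $ i) e = 0)"
proof -
  have eq: "{e. map_vec (\<lambda>p. coeff p e) v \<noteq> 0\<^sub>v (dim_vec v)} =
      {e. \<exists>i\<in>{..<dim_vec v}. coeff (v $ i) e \<noteq> 0}" by (auto simp: vec_eq_iff)
  show ?thesis
    unfolding vec_deg_def eq by (subst Sup_coeff_support_le_iff) auto
qed

lemma mat_deg_le_iff:
  "mat_deg P \<le> k \<longleftrightarrow> (\<forall>i<dim_row P. \<forall>j<dim_col P. \<forall>e>k. coeff (P $$ (i, j)) e = 0)"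
proof -
  have eq: "{e. coeff_mat P e \<noteq> 0\<^sub>m (dim_row P) (dim_col P)} =
      {e. \<exists>x\<in>{..<dim_row P} \<times> {..<dim_col P}. coeff (P $$ x) e \<noteq> 0}"
    by (auto simp: mat_eq_iff coeff_mat_def)
  show ?thesis
    unfolding mat_deg_def eq by (subst Sup_coeff_support_le_iff) auto
qed

lemma graded_mat_deg: "P \<in> graded k p q \<longleftrightarrow> P \<in> carrier_mat p q \<and> mat_deg P \<le> k"
  by (auto simp: graded_iff mat_deg_le_iff)

lemma graded_coeff:
  assumes "P \<in> graded k p q" "i < p" "j < q" "e > k"
  shows "coeff (P $$ (i, j)) e = 0"
  using assms by (auto simp: graded_iff)

lemma graded_transpose: "P \<in> graded k p q \<Longrightarrow> P\<^sup>T \<in> graded k q p"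
  by (auto simp: graded_iff)

lemma graded_add:
  fixes P Q :: "'a::comm_monoid_add poly mat"
  shows "P \<in> graded k p q \<Longrightarrow> Q \<in> graded k p q \<Longrightarrow> P + Q \<in> graded k p q"
  by (auto simp: graded_iff)

lemma graded_diff:
  fixes P Q :: "'a::ab_group_add poly mat"
  shows "P \<in> graded k p q \<Longrightarrow> Q \<in> graded k p q \<Longrightarrow> P - Q \<in> graded k p q"
  by (auto simp: graded_iff intro: minus_carrier_mat)

lemma graded_carrier: "P \<in> graded k p q \<Longrightarrow> P \<in> carrier_mat p q"
  by (simp add: graded_iff)

lemma coeff_mult_at_bound:
  fixes p r :: "'a::comm_semiring_0 poly"
  assumes "\<And>e. e > m \<Longrightarrow> coeff p e = 0" "\<And>e. e > n \<Longrightarrow> coeff r e = 0"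
  shows "coeff (p * r) (m + n) = coeff p m * coeff r n"
proof -
  have "coeff (p * r) (m + n) = (\<Sum>i\<in>{m}. coeff p i * coeff r (m + n - i))"
    unfolding coeff_mult
  proof (rule sum.mono_neutral_right)
    show "\<forall>i\<in>{..m + n} - {m}. coeff p i * coeff r (m + n - i) = 0"
    proof
      fix i assume i: "i \<in> {..m + n} - {m}"
      show "coeff p i * coeff r (m + n - i) = 0"
      proof (cases "i > m")
        case False
        then have "m + n - i > n" using i by auto
        then show ?thesis by (simp add: assms)
      qed (simp add: assms)
    qed
  qed auto
  then show ?thesis by simp
qed

lemma coeff_mult_above_bound:
  fixes p r :: "'a::comm_semiring_0 poly"
  assumes "\<And>e. e > m \<Longrightarrow> coeff p e = 0" "\<And>e. e \<ge> n \<Longrightarrow> coeff r e = 0" and "e \<ge> m + n"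
  shows "coeff (p * r) e = 0"
  unfolding coeff_mult
proof (rule sum.neutral, rule ballI)
  fix i assume "i \<in> {..e}"
  show "coeff p i * coeff r (e - i) = 0"
  proof (cases "i > m")
    case False
    then have "e - i \<ge> n" using assms(3) by auto
    then show ?thesis by (simp add: assms)
  qed (simp add: assms)
qed

lemma row_degrees_graded:
  assumes "K \<in> carrier_mat s q" "row_degrees_eq K \<kappa>"
  shows "K \<in> graded \<kappa> s q"
proof -
  have "\<forall>i<s. vec_deg (row K i) \<le> \<kappa>" using assms by (auto simp: row_degrees_eq_def)
  then show ?thesis using assms(1) by (auto simp: vec_deg_le_iff graded_iff)
qed

lemma graded_mult:
  fixes N B :: "'a::comm_semiring_0 poly mat"
  assumes N: "N \<in> graded \<nu> t q" and B: "B \<in> graded b q r"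
  shows "N * B \<in> graded (\<nu> + b) t r"
proof -
  have Nc: "N \<in> carrier_mat t q" and Bc: "B \<in> carrier_mat q r" using N B by (auto simp: graded_iff)
  have "coeff ((N * B) $$ (i, j)) e = 0" if "i < t" "j < r" "e > \<nu> + b" for i j e
  proof -
    have "coeff ((N * B) $$ (i, j)) e = (\<Sum>k<q. coeff (N $$ (i, k) * B $$ (k, j)) e)"
      using that Nc Bc by (simp add: scalar_prod_def atLeast0LessThan coeff_sum)
    also have "\<dots> = 0"
      using that by (intro sum.neutral ballI coeff_mult_above_bound[of \<nu> _ "b + 1"])
        (auto intro: graded_coeff[OF N] graded_coeff[OF B])
    finally show ?thesis .
  qed
  then show ?thesis using Nc Bc by (auto simp: graded_iff simp del: index_mult_mat(1))
qed

section \<open>Minimal bases with equal row degrees\<close>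

lemma index_transpose_mult:
  assumes "K \<in> carrier_mat s q" "A \<in> carrier_mat s r" "i < q" "j < r"
  shows "(K\<^sup>T * A) $$ (i, j) = (\<Sum>k<s. K $$ (k, i) * (A $$ (k, j) :: 'a::comm_semiring_0))"
  using assms by (simp add: scalar_prod_def atLeast0LessThan)

abbreviation rat_mat :: "'a::field poly mat \<Rightarrow> 'a poly fract mat" where
  "rat_mat \<equiv> map_mat to_fract"

interpretation to_fract_hom: inj_comm_ring_hom "to_fract :: 'a::field poly \<Rightarrow> 'a poly fract"
  by unfold_locales auto

lemma rat_vec_inj: "rat_vec u = rat_vec v \<longleftrightarrow> u = v"
  by (auto simp: vec_eq_iff)

lemma rat_rows:
  assumes "K \<in> carrier_mat s q"
  shows "mat_of_cols q (map rat_vec (rows K)) = (rat_mat K)\<^sup>T"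
  using assms by (intro eq_matI) (auto simp: mat_of_cols_def)

lemma common_denominator:
  fixes X :: "'a::field poly fract mat"
  assumes X: "X \<in> carrier_mat s r"
  shows "\<exists>g Y. g \<noteq> 0 \<and> Y \<in> carrier_mat s r \<and> rat_mat Y = to_fract g \<cdot>\<^sub>m X"
proof -
  have "\<exists>g. g \<noteq> 0 \<and> (\<forall>x\<in>I. \<exists>y. to_fract y = to_fract g * X $$ x)" if "finite I" for I
    using that
  proof induction
    case (insert x I)
    then obtain g where g: "g \<noteq> 0" "\<forall>x\<in>I. \<exists>y. to_fract y = to_fract g * X $$ x" by blast
    obtain a b where ab: "X $$ x = Fract a b" "b \<noteq> 0" by (rule Fract_cases)
    have x: "to_fract (g * a) = to_fract (g * b) * X $$ x"
      using ab(2) unfolding ab(1) Fract_conv_to_fract to_fract_mult by simp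
    have "\<exists>y'. to_fract y' = to_fract (g * b) * X $$ y" if "y \<in> I" for y
    proof -
      from bspec[OF g(2) that] obtain y' where "to_fract y' = to_fract g * X $$ y" ..
      then have "to_fract (b * y') = to_fract (g * b) * X $$ y" by simp
      then show ?thesis ..
    qed
    then have "\<forall>y\<in>insert x I. \<exists>y'. to_fract y' = to_fract (g * b) * X $$ y" using x by blast
    moreover have "g * b \<noteq> 0" using g(1) ab(2) by simp
    ultimately show ?case by blast
  qed (auto intro: exI[of _ 1])
  from this[of "{..<s} \<times> {..<r}"]
  obtain g where "g \<noteq> 0" "\<forall>x\<in>{..<s} \<times> {..<r}. \<exists>y. to_fract y = to_fract g * X $$ x" by auto
  then obtain y where "\<forall>x\<in>{..<s} \<times> {..<r}. to_fract (y x) = to_fract g * X $$ x" by metis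
  then have "rat_mat (mat s r y) = to_fract g \<cdot>\<^sub>m X" using X by (intro eq_matI) auto
  then show ?thesis using \<open>g \<noteq> 0\<close> by (intro exI[of _ g] exI[of _ "mat s r y"]) auto
qed

lemma rat_mat_mult:
  assumes "K \<in> carrier_mat s q" "A \<in> carrier_mat s r"
  shows "rat_mat (K\<^sup>T * A) = (rat_mat K)\<^sup>T * rat_mat A"
  using assms by (subst to_fract_hom.mat_hom_mult[of _ q s _ r]) (auto simp: map_mat_transpose)

lemma minimal_basisD:
  assumes "minimal_basis s q K"
  shows "K \<in> carrier_mat s q" "s < q" "set (map rat_vec (rows K)) \<subseteq> carrier_vec q"
    "distinct (map rat_vec (rows K))" "rat_indep q (set (rows K))"
    "\<And>B. poly_basis_of q (rat_span q (set (rows K))) B \<Longrightarrow> sum vec_deg (set (rows K)) \<le> sum vec_deg B"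
proof -
  show "K \<in> carrier_mat s q" "s < q" "rat_indep q (set (rows K))"
    "\<And>B. poly_basis_of q (rat_span q (set (rows K))) B \<Longrightarrow> sum vec_deg (set (rows K)) \<le> sum vec_deg B"
    using assms by (auto simp: minimal_basis_def minimal_basis_of_def poly_basis_of_def)
  then show "set (map rat_vec (rows K)) \<subseteq> carrier_vec q" by (auto simp: rows_def)
  have "inj_on rat_vec (set (rows K))" by (rule inj_onI) (simp add: rat_vec_inj)
  then show "distinct (map rat_vec (rows K))"
    using assms by (simp add: minimal_basis_def distinct_map)
qed

lemma minimal_basis_independent:
  assumes K: "minimal_basis s q K" and z: "z \<in> carrier_vec s" "(rat_mat K)\<^sup>T *\<^sub>v z = 0\<^sub>v q"
  shows "z = 0\<^sub>v s"
proof -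
  note D = minimal_basisD[OF K]
  interpret vec_space "TYPE('a poly fract)" q .
  have len: "length (map rat_vec (rows K)) = s" using D(1) by simp
  have "lin_indpt (set (map rat_vec (rows K)))"
    using D(5) by (simp add: rat_indep_def)
  from lin_indpt_mat_of_cols_mult[OF D(3,4) this, unfolded len rat_rows[OF D(1)], OF z]
  show ?thesis .
qed

text \<open>Exchanging a row of degree \<open>\<kappa>\<close> for a nonzero \<open>w\<close> of smaller degree would decrease the sum of
  the degrees.\<close>

lemma minimal_basis_no_low_degree:
  assumes K: "minimal_basis s q K" and deg: "row_degrees_eq K \<kappa>"
    and w: "w \<in> carrier_vec q" "\<And>i e. i < q \<Longrightarrow> \<kappa> \<le> e \<Longrightarrow> coeff (w $ i) e = 0"
    and z: "z \<in> carrier_vec s" "rat_vec w = (rat_mat K)\<^sup>T *\<^sub>v z"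
  shows "w = 0\<^sub>v q"
proof (rule ccontr)
  assume w0: "w \<noteq> 0\<^sub>v q"
  note D = minimal_basisD[OF K]
  interpret vec_space "TYPE('a poly fract)" q .
  define S where "S = set (rows K)"
  have S: "finite S" "S \<subseteq> carrier_vec q" using D(1) by (auto simp: S_def rows_def)
  have ratS: "rat_vec ` S = set (map rat_vec (rows K))" by (simp add: S_def)
  have len: "length (map rat_vec (rows K)) = s" using D(1) by simp
  have w_in: "rat_vec w \<in> span (rat_vec ` S)"
    using mat_of_cols_mult_in_span[OF D(3), unfolded len, OF z(1)]
    unfolding rat_rows[OF D(1)] z(2)[symmetric] ratS .
  have rw0: "rat_vec w \<noteq> 0\<^sub>v q" using w0 w(1) by (auto simp: vec_eq_iff)
  have "\<exists>u\<in>rat_vec ` S. lin_indpt (insert (rat_vec w) (rat_vec ` S - {u})) \<and>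
      span (insert (rat_vec w) (rat_vec ` S - {u})) = span (rat_vec ` S)"
    using S(1) D(3,5) by (intro exchange_basis w_in rw0) (auto simp: ratS[symmetric] rat_indep_def S_def)
  then obtain u where u: "u \<in> S"
    "lin_indpt (insert (rat_vec w) (rat_vec ` S - {rat_vec u}))"
    "span (insert (rat_vec w) (rat_vec ` S - {rat_vec u})) = span (rat_vec ` S)"
    by blast
  have im: "rat_vec ` (insert w (S - {u})) = insert (rat_vec w) (rat_vec ` S - {rat_vec u})"
    by (auto simp: rat_vec_inj)
  have "poly_basis_of q (rat_span q S) (insert w (S - {u}))"
    unfolding poly_basis_of_def rat_indep_def rat_span_def im
    using u S w(1) by auto
  from D(6)[folded S_def, OF this]
  have le: "sum vec_deg S \<le> sum vec_deg (insert w (S - {u}))" .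
  have deg_S: "vec_deg v = \<kappa>" if "v \<in> S" for v
    using that deg by (auto simp: S_def rows_def row_degrees_eq_def)
  have "0 < \<kappa>"
  proof (rule ccontr)
    assume "\<not> 0 < \<kappa>"
    then have "w $ i = 0" if "i < q" for i using w(2)[OF that] by (intro poly_eqI) simp
    then show False using w(1) w0 by (auto simp: vec_eq_iff)
  qed
  then have deg_w: "vec_deg w < \<kappa>"
    using vec_deg_le_iff[of w "\<kappa> - 1"] w by auto
  have "sum vec_deg (insert w (S - {u})) = vec_deg w + sum vec_deg (S - {u})"
    using S(1) deg_w deg_S by (intro sum.insert) auto
  moreover have "sum vec_deg S = vec_deg u + sum vec_deg (S - {u})"
    using S(1) u(1) by (rule sum.remove)
  ultimately show False using le deg_w deg_S[OF u(1)] by simp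
qed

text \<open>The rows of leading coefficients of \<open>K\<close> are independent over \<open>F\<close>: a dependence between them gives
  a combination of the rows of \<open>K\<close> of degree less than \<open>\<kappa>\<close>, which is zero. Hence the highest
  coefficients of \<open>A\<close> cannot cancel in \<open>K\<^sup>T A\<close>.\<close>

lemma minimal_basis_predictable_degree:
  assumes K: "minimal_basis s q K" and deg: "row_degrees_eq K \<kappa>"
    and A: "A \<in> carrier_mat s r" "j < r"
    and b: "\<And>i e. i < q \<Longrightarrow> b < e \<Longrightarrow> coeff ((K\<^sup>T * A) $$ (i, j)) e = 0"
    and ke: "k < s" "b < e + \<kappa>"
  shows "coeff (A $$ (k, j)) e = 0"
proof (rule ccontr)
  assume nz: "coeff (A $$ (k, j)) e \<noteq> 0"
  note D = minimal_basisD[OF K]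
  have gK: "K \<in> graded \<kappa> s q" by (rule row_degrees_graded[OF D(1) deg])
  define E where "E = {e. \<exists>k<s. coeff (A $$ (k, j)) e \<noteq> 0}"
  have "finite E"
  proof (rule finite_subset)
    show "E \<subseteq> (\<Union>k<s. {..degree (A $$ (k, j))})" using le_degree by (fastforce simp: E_def)
  qed auto
  \<comment> \<open>The highest degree in column \<open>j\<close>; its coefficients form the dependence to be excluded.\<close>
  define f where "f = Max E"
  have "e \<in> E" using nz ke by (auto simp: E_def)
  then have f: "f \<in> E" "e \<le> f" "\<And>e. e \<in> E \<Longrightarrow> e \<le> f"
    using \<open>finite E\<close> by (auto simp: f_def intro: Max_in)
  have above_f: "coeff (A $$ (k, j)) e = 0" if "k < s" "e > f" for k e
    using f(3)[of e] that by (force simp: E_def)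
  define z where "z = vec s (\<lambda>k. [:coeff (A $$ (k, j)) f:])"
  have z: "z \<in> carrier_vec s" by (simp add: z_def)
  define w where "w = K\<^sup>T *\<^sub>v z"
  have w: "w \<in> carrier_vec q" using D(1) z by (simp add: w_def)
  have w_ix: "w $ i = (\<Sum>k<s. Polynomial.smult (coeff (A $$ (k, j)) f) (K $$ (k, i)))" if "i < q" for i
    using that D(1) z by (simp add: w_def z_def scalar_prod_def atLeast0LessThan)
  have low: "coeff (w $ i) e = 0" if "i < q" "\<kappa> \<le> e" for i e
  proof (cases "e = \<kappa>")
    case True
    have "coeff (w $ i) e = (\<Sum>k<s. coeff (K $$ (k, i)) \<kappa> * coeff (A $$ (k, j)) f)"
      by (simp add: w_ix[OF that(1)] coeff_sum True mult.commute)
    also have "\<dots> = (\<Sum>k<s. coeff (K $$ (k, i) * A $$ (k, j)) (\<kappa> + f))"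
      using that gK above_f by (intro sum.cong coeff_mult_at_bound[symmetric]) (auto intro: graded_coeff)
    also have "\<dots> = coeff ((K\<^sup>T * A) $$ (i, j)) (\<kappa> + f)"
      by (simp only: index_transpose_mult[OF D(1) A(1) that(1) A(2)] coeff_sum)
    also have "\<dots> = 0" using f(2) ke(2) that by (intro b) auto
    finally show ?thesis .
  next
    case False
    then show ?thesis using that graded_coeff[OF gK _ that(1)]
      by (simp add: w_ix coeff_sum)
  qed
  have rz: "rat_vec z \<in> carrier_vec s" using z by simp
  have hw: "rat_vec w = (rat_mat K)\<^sup>T *\<^sub>v rat_vec z"
    using z D(1) by (intro eq_vecI) (auto simp: w_def scalar_prod_def)
  have "w = 0\<^sub>v q" by (rule minimal_basis_no_low_degree[OF K deg w low rz hw])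
  then have "(rat_mat K)\<^sup>T *\<^sub>v rat_vec z = 0\<^sub>v q" unfolding hw[symmetric] by auto
  from minimal_basis_independent[OF K rz this]
  have "rat_vec z = 0\<^sub>v s" .
  then have "coeff (A $$ (k, j)) f = 0" if "k < s" for k
    using that by (auto simp: z_def vec_eq_iff)
  then show False using f(1) by (auto simp: E_def)
qed

text \<open>Let \<open>g\<close> be a common denominator of \<open>X\<close> and divide \<open>g X\<close> by \<open>g\<close>, with quotient \<open>A\<close> and remainder
  \<open>R\<close>. Then \<open>g (B - K\<^sup>T A) = K\<^sup>T R\<close> has degree less than \<open>\<kappa> + deg g\<close>, so \<open>B - K\<^sup>T A\<close> has degree less
  than \<open>\<kappa>\<close> and vanishes.\<close>

lemma minimal_basis_polynomial_coordinates:
  assumes K: "minimal_basis s q K" and deg: "row_degrees_eq K \<kappa>"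
    and B: "B \<in> carrier_mat q r" and X: "X \<in> carrier_mat s r"
    and BX: "rat_mat B = (rat_mat K)\<^sup>T * X"
  shows "\<exists>A \<in> carrier_mat s r. B = K\<^sup>T * A"
proof -
  note D = minimal_basisD[OF K]
  have gK: "K \<in> graded \<kappa> s q" by (rule row_degrees_graded[OF D(1) deg])
  obtain g Y where g: "g \<noteq> 0" and Y: "Y \<in> carrier_mat s r" and gY: "rat_mat Y = to_fract g \<cdot>\<^sub>m X"
    using common_denominator[OF X] by blast
  define A where "A = map_mat (\<lambda>p. p div g) Y"
  define R where "R = map_mat (\<lambda>p. p mod g) Y"
  have A: "A \<in> carrier_mat s r" and R: "R \<in> carrier_mat s r" using Y by (auto simp: A_def R_def)
  have KA: "K\<^sup>T * A \<in> carrier_mat q r" using D(1) A by auto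
  have KR: "K\<^sup>T * R \<in> carrier_mat q r" using D(1) R by auto
  define W where "W = B - K\<^sup>T * A"
  have W: "W \<in> carrier_mat q r" unfolding W_def by (rule minus_carrier_mat[OF KA])
  have W_ix: "W $$ (i, j) = B $$ (i, j) - (K\<^sup>T * A) $$ (i, j)" if "i < q" "j < r" for i j
    unfolding W_def using that KA by (intro index_minus_mat) auto
  have gW: "g * W $$ (i, j) = (K\<^sup>T * R) $$ (i, j)" if "i < q" "j < r" for i j
  proof -
    have "to_fract (B $$ (i, j)) = (\<Sum>k<s. to_fract (K $$ (k, i)) * X $$ (k, j))"
      using arg_cong[OF BX, of "\<lambda>M. M $$ (i, j)"] that B D(1)
        index_transpose_mult[of "rat_mat K" s q X r i j] X
      by (simp del: index_mult_mat)
    then have "to_fract (g * B $$ (i, j)) = (\<Sum>k<s. to_fract (K $$ (k, i)) * (to_fract g * X $$ (k, j)))"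
      by (simp add: sum_distrib_left mult_ac)
    also have "\<dots> = (\<Sum>k<s. to_fract (K $$ (k, i)) * to_fract (Y $$ (k, j)))"
    proof (rule sum.cong)
      fix k assume "k \<in> {..<s}"
      then show "to_fract (K $$ (k, i)) * (to_fract g * X $$ (k, j)) =
          to_fract (K $$ (k, i)) * to_fract (Y $$ (k, j))"
        using arg_cong[OF gY, of "\<lambda>M. M $$ (k, j)"] X Y that by simp
    qed simp
    finally have "g * B $$ (i, j) = (\<Sum>k<s. K $$ (k, i) * Y $$ (k, j))"
      by (simp only: to_fract_mult[symmetric] to_fract_sum[symmetric] to_fract_eq_iff)
    moreover have "Y $$ (k, j) = g * A $$ (k, j) + R $$ (k, j)" if "k < s" for k
      using that \<open>j < r\<close> Y by (simp add: A_def R_def)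
    ultimately have "g * B $$ (i, j) = g * (\<Sum>k<s. K $$ (k, i) * A $$ (k, j)) + (\<Sum>k<s. K $$ (k, i) * R $$ (k, j))"
      by (simp add: algebra_simps sum.distrib sum_distrib_left)
    then show ?thesis
      using that by (simp add: W_ix index_transpose_mult[OF D(1) A] index_transpose_mult[OF D(1) R] algebra_simps)
  qed
  have R_deg: "coeff (R $$ (k, j)) e = 0" if "k < s" "j < r" "degree g \<le> e" for k j e
    using degree_mod_less[OF g, of "Y $$ (k, j)"] that Y by (auto simp: R_def intro: coeff_eq_0)
  have low: "coeff (W $$ (i, j)) e = 0" if "i < q" "j < r" "\<kappa> \<le> e" for i j e
  proof (rule ccontr)
    assume nz: "coeff (W $$ (i, j)) e \<noteq> 0"
    then have "W $$ (i, j) \<noteq> 0" "e \<le> degree (W $$ (i, j))" by (auto intro: le_degree)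
    have "coeff ((K\<^sup>T * R) $$ (i, j)) f = 0" if "\<kappa> + degree g \<le> f" for f
      unfolding index_transpose_mult[OF D(1) R \<open>i < q\<close> \<open>j < r\<close>] coeff_sum
      using that R_deg \<open>i < q\<close> \<open>j < r\<close>
      by (intro sum.neutral ballI coeff_mult_above_bound[of \<kappa> _ "degree g"])
        (auto intro: graded_coeff[OF gK])
    then have "coeff (g * W $$ (i, j)) (degree g + degree (W $$ (i, j))) = 0"
      unfolding gW[OF that(1,2)] using \<open>e \<le> _\<close> \<open>\<kappa> \<le> e\<close> by simp
    then show False using g \<open>W $$ (i, j) \<noteq> 0\<close> by (simp add: coeff_mult_degree_sum)
  qed
  define Z where "Z = X - rat_mat A"
  have Z: "Z \<in> carrier_mat s r" using X A by (auto simp: Z_def)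
  have rA: "rat_mat A \<in> carrier_mat s r" using A by simp
  have rK: "(rat_mat K)\<^sup>T \<in> carrier_mat q s" using D(1) by auto
  have "rat_mat W = rat_mat B - rat_mat (K\<^sup>T * A)"
    using B KA W by (intro eq_matI) (auto simp: W_ix simp del: index_mult_mat)
  also have "\<dots> = (rat_mat K)\<^sup>T * Z"
    unfolding BX rat_mat_mult[OF D(1) A] Z_def
    by (rule mult_minus_distrib_mat[OF rK X rA, symmetric])
  finally have WZ: "rat_mat W = (rat_mat K)\<^sup>T * Z" .
  have "col W j = 0\<^sub>v q" if j: "j < r" for j
  proof (rule minimal_basis_no_low_degree[OF K deg])
    show "rat_vec (col W j) = (rat_mat K)\<^sup>T *\<^sub>v col Z j"
      unfolding col_mult2[OF rK Z j, symmetric] WZ[symmetric]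
      using W j by (intro eq_vecI) auto
    show "coeff (col W j $ i) e = 0" if "i < q" "\<kappa> \<le> e" for i e
      using low[OF that(1) j that(2)] W that j by simp
  qed (use W Z j in auto)
  then have W0: "W $$ (i, j) = 0" if "i < q" "j < r" for i j

  proof -
    have "W $$ (i, j) = col W j $ i" using that W by simp
    then show ?thesis using that \<open>\<And>j. j < r \<Longrightarrow> col W j = 0\<^sub>v q\<close> by simp
  qed
  have "B = K\<^sup>T * A"
  proof (rule eq_matI)
    fix i j assume "i < dim_row (K\<^sup>T * A)" "j < dim_col (K\<^sup>T * A)"
    then have "i < q" "j < r" using KA by auto
    then show "B $$ (i, j) = (K\<^sup>T * A) $$ (i, j)" using W0 W_ix by (metis eq_iff_diff_eq_0)
  qed (use B KA in auto)
  then show ?thesis using A by blast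
qed

lemma minimal_basis_mult_inj:
  assumes K: "minimal_basis s q K" and X: "X \<in> carrier_mat s r" "X' \<in> carrier_mat s r"
    and eq: "K\<^sup>T * X = K\<^sup>T * X'"
  shows "X = X'"
proof -
  have Kc: "K \<in> carrier_mat s q" using K by (rule minimal_basisD(1))
  define Z where "Z = rat_mat X - rat_mat X'"
  have rX: "rat_mat X \<in> carrier_mat s r" "rat_mat X' \<in> carrier_mat s r" using X by auto
  have Z: "Z \<in> carrier_mat s r" using rX by (auto simp: Z_def)
  have rK: "(rat_mat K)\<^sup>T \<in> carrier_mat q s" using Kc by auto
  have "(rat_mat K)\<^sup>T * Z = (rat_mat K)\<^sup>T * rat_mat X - (rat_mat K)\<^sup>T * rat_mat X'"
    unfolding Z_def by (rule mult_minus_distrib_mat[OF rK rX])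
  also have "\<dots> = 0\<^sub>m q r"
    unfolding rat_mat_mult[OF Kc X(1), symmetric] rat_mat_mult[OF Kc X(2), symmetric] eq
    using Kc X by (intro minus_r_inv_mat) auto
  finally have KZ: "(rat_mat K)\<^sup>T * Z = 0\<^sub>m q r" .
  have col0: "col Z j = 0\<^sub>v s" if "j < r" for j
  proof (rule minimal_basis_independent[OF K])
    show "(rat_mat K)\<^sup>T *\<^sub>v col Z j = 0\<^sub>v q"
      unfolding col_mult2[OF rK Z that, symmetric] KZ using that by auto
  qed (use Z that in auto)
  have "X $$ (i, j) = X' $$ (i, j)" if "i < s" "j < r" for i j
  proof -
    have "Z $$ (i, j) = 0" 
    proof -
      have "Z $$ (i, j) = col Z j $ i" using that Z by simp
      then show ?thesis using that col0 by simp
    qed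
    then show ?thesis using X that by (simp add: Z_def)
  qed
  then show ?thesis using X by (intro eq_matI) auto
qed

section \<open>The kernel of a minimal basis\<close>

lemma dual_minimal_basesD:
  assumes "dual_minimal_bases s t q K N"
  shows "s + t = q" "minimal_basis s q K" "minimal_basis t q N" "K * N\<^sup>T = 0\<^sub>m s t" "N * K\<^sup>T = 0\<^sub>m t s"
proof -
  show *: "s + t = q" "minimal_basis s q K" "minimal_basis t q N" "K * N\<^sup>T = 0\<^sub>m s t"
    using assms by (auto simp: dual_minimal_bases_def)
  have KN: "K \<in> carrier_mat s q" "N \<in> carrier_mat t q"
    using minimal_basisD(1)[OF *(2)] minimal_basisD(1)[OF *(3)] by simp_all
  have "(K * N\<^sup>T)\<^sup>T = N * K\<^sup>T"
    using KN by (subst transpose_mult[of _ s q _ t]) auto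
  then show "N * K\<^sup>T = 0\<^sub>m t s" unfolding *(4) by simp
qed

lemma dual_minimal_bases_sym:
  assumes "dual_minimal_bases s t q K N"
  shows "dual_minimal_bases t s q N K"
  unfolding dual_minimal_bases_def
  using dual_minimal_basesD[OF assms] by (simp only: add.commute[of t s] simp_thms)

text \<open>Take a left inverse \<open>H\<close> of \<open>L = K\<^sup>T\<close> and a right inverse of \<open>A = N\<close>, corrected to some \<open>G'\<close> with
  \<open>H G' = 0\<close>. As \<open>s + t = q\<close>, it follows that \<open>G' A + L H = 1\<close>, and \<open>G' A\<close> annihilates the
  kernel.\<close>

lemma rational_kernel_of_dual:
  assumes KN: "dual_minimal_bases s t q K N"
    and B: "B \<in> carrier_mat q r" and NB: "N * B = 0\<^sub>m t r"
  shows "\<exists>X \<in> carrier_mat s r. rat_mat B = (rat_mat K)\<^sup>T * X"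
proof -
  note D = dual_minimal_basesD[OF KN]
  have K: "K \<in> carrier_mat s q" and N: "N \<in> carrier_mat t q"
    using minimal_basisD(1)[OF D(2)] minimal_basisD(1)[OF D(3)] by simp_all
  define L where "L = (rat_mat K)\<^sup>T"
  define A where "A = rat_mat N"
  have L: "L \<in> carrier_mat q s" and A: "A \<in> carrier_mat t q" using K N by (auto simp: L_def A_def)
  have AL: "A * L = 0\<^sub>m t s"
    unfolding A_def L_def map_mat_transpose
    using to_fract_hom.mat_hom_mult[of N t q "K\<^sup>T" s, symmetric] K N
    by (simp add: D(5) mat_eq_iff)
  obtain H where H: "H \<in> carrier_mat s q" "H * L = 1\<^sub>m s"
    using left_inverse_exists[OF L] minimal_basis_independent[OF D(2)] L_def by blast
  have AT: "A\<^sup>T \<in> carrier_mat q t" using A by auto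
  obtain G where G: "G \<in> carrier_mat t q" "G * A\<^sup>T = 1\<^sub>m t"
    using left_inverse_exists[OF AT] minimal_basis_independent[OF D(3)] A_def by blast
  define G' where "G' = G\<^sup>T - L * (H * G\<^sup>T)"
  have GT: "G\<^sup>T \<in> carrier_mat q t" using G by auto
  have AGT: "A * G\<^sup>T = 1\<^sub>m t"
    using arg_cong[OF G(2), of transpose_mat] transpose_mult[OF G(1) AT] by simp
  have HG: "H * G\<^sup>T \<in> carrier_mat s t" using H GT by auto
  have LHG: "L * (H * G\<^sup>T) \<in> carrier_mat q t" using L HG by auto
  have G': "G' \<in> carrier_mat q t" unfolding G'_def by (rule minus_carrier_mat[OF LHG])
  have "A * (L * (H * G\<^sup>T)) = 0\<^sub>m t t"
    using assoc_mult_mat[OF A L HG, symmetric] left_mult_zero_mat[OF HG] by (simp only: AL)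
  then have AG': "A * G' = 1\<^sub>m t"
    unfolding G'_def mult_minus_distrib_mat[OF A GT LHG] AGT by auto
  have "H * (L * (H * G\<^sup>T)) = H * G\<^sup>T"
    using assoc_mult_mat[OF H(1) L HG, symmetric] left_mult_one_mat[OF HG] by (simp only: H(2))
  then have HG': "H * G' = 0\<^sub>m s t"
    unfolding G'_def mult_minus_distrib_mat[OF H(1) GT LHG] using HG by auto
  have one: "G' * A + L * H = 1\<^sub>m q"
    unfolding paired_factors_of_identity[OF G' L A H(1) D(1)[symmetric, unfolded add.commute[of s]]]
    using AG' HG' AL H(2) by simp
  have rB: "rat_mat B \<in> carrier_mat q r" using B by simp
  have AB: "A * rat_mat B = 0\<^sub>m t r"
    unfolding A_def unfolding to_fract_hom.mat_hom_mult[OF N B, symmetric] NB by (intro eq_matI) auto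
  have GA: "G' * A \<in> carrier_mat q q" and LH: "L * H \<in> carrier_mat q q" using G' A L H by auto
  have "rat_mat B = (G' * A + L * H) * rat_mat B" unfolding one using rB by simp
  also have "\<dots> = G' * A * rat_mat B + L * H * rat_mat B"
    by (rule add_mult_distrib_mat[OF GA LH rB])
  also have "G' * A * rat_mat B = 0\<^sub>m q r"
    unfolding assoc_mult_mat[OF G' A rB] AB using G' by simp
  also have "L * H * rat_mat B = L * (H * rat_mat B)" by (rule assoc_mult_mat[OF L H(1) rB])
  also have "0\<^sub>m q r + L * (H * rat_mat B) = L * (H * rat_mat B)"
    by (rule left_add_zero_mat[OF mult_carrier_mat[OF L mult_carrier_mat[OF H(1) rB]]])
  finally show ?thesis
    unfolding L_def by (rule bexI[OF _ mult_carrier_mat[OF H(1) rB]])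
qed

text \<open>The rational coordinates of \<open>B\<close> are polynomials, and as degrees add up without cancellation
  they have grade \<open>b - \<kappa>\<close>.\<close>

theorem kernel_of_dual:
  assumes KN: "dual_minimal_bases s t q K N" and deg: "row_degrees_eq K \<kappa>"
    and B: "B \<in> graded b q r" and NB: "N * B = 0\<^sub>m t r" and b: "\<kappa> \<le> b"
  shows "\<exists>X \<in> graded (b - \<kappa>) s r. B = K\<^sup>T * X"
proof -
  have Bc: "B \<in> carrier_mat q r" using B by (simp add: graded_iff)
  have K: "minimal_basis s q K" by (rule dual_minimal_basesD(2)[OF KN])
  obtain X where X: "X \<in> carrier_mat s r" "B = K\<^sup>T * X"
    using rational_kernel_of_dual[OF KN Bc NB] minimal_basis_polynomial_coordinates[OF K deg Bc] by blast
  have "coeff (X $$ (k, j)) e = 0" if "k < s" "j < r" "b - \<kappa> < e" for k j e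
  proof (rule minimal_basis_predictable_degree[OF K deg X(1) that(2) _ that(1)])
    show "coeff ((K\<^sup>T * X) $$ (i, j)) f = 0" if "i < q" "b < f" for i f
      using graded_coeff[OF B that(1) \<open>j < r\<close> that(2)] unfolding X(2)[symmetric] .
    show "b < e + \<kappa>" using that b by simp
  qed
  then show ?thesis using X by (auto simp: graded_iff)
qed

section \<open>Convolution matrices as multiplication operators\<close>

lemma sum_blocks:
  fixes f :: "nat \<Rightarrow> 'a::comm_monoid_add"
  shows "(\<Sum>\<gamma><n * q. f \<gamma>) = (\<Sum>\<beta><n. \<Sum>j<q. f (\<beta> * q + j))"
proof -
  have "sum f {\<beta> * q..<\<beta> * q + q} = (\<Sum>j<q. f (\<beta> * q + j))" for \<beta>
    using sum.shift_bounds_nat_ivl[of f 0 "\<beta> * q" q] by (simp add: atLeast0LessThan add.commute)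
  then show ?thesis by (simp add: sum.nat_group[symmetric])
qed

text \<open>The product formula in the indexing of convolution matrices, which list coefficients from the
  highest one down.\<close>

lemma coeff_mult_from_top:
  fixes p r :: "'a::comm_semiring_0 poly"
  assumes p: "\<And>e. e > \<nu> \<Longrightarrow> coeff p e = 0" and r: "\<And>e. e > b \<Longrightarrow> coeff r e = 0"
    and a: "a \<le> \<nu> + b"
  shows "coeff (p * r) (\<nu> + b - a) =
    (\<Sum>\<beta><b + 1. (if \<beta> \<le> a \<and> a \<le> \<beta> + \<nu> then coeff p (\<nu> + \<beta> - a) else 0) * coeff r (b - \<beta>))"
proof -
  define M where "M = \<nu> + b - a"
  define F where "F \<beta> = (if \<beta> \<le> a \<and> a \<le> \<beta> + \<nu> then coeff p (\<nu> + \<beta> - a) else 0) * coeff r (b - \<beta>)" for \<beta>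
  have r': "i \<le> b" if "coeff p (M - i) * coeff r i \<noteq> 0" for i
    using r[of i] that by (cases "i \<le> b") auto
  have "coeff (p * r) M = coeff (r * p) M" by (simp only: mult.commute[of p r])
  also have "\<dots> = (\<Sum>e\<le>M. coeff p (M - e) * coeff r e)"
    unfolding coeff_mult by (rule sum.cong[OF refl], rule mult.commute)
  also have "\<dots> = (\<Sum>e\<in>{..b} \<inter> {..M}. coeff p (M - e) * coeff r e)"
    by (rule sum.mono_neutral_right) (auto intro: r')
  also have "\<dots> = (\<Sum>e\<le>b. F (b - e))"
  proof (rule sum.mono_neutral_cong_left)
    show "\<forall>e\<in>{..b} - {..b} \<inter> {..M}. F (b - e) = 0" using a by (auto simp: F_def M_def)
    show "coeff p (M - e) * coeff r e = F (b - e)" if "e \<in> {..b} \<inter> {..M}" for e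
    proof (cases "b - e \<le> a")
      case True
      then have "\<nu> + (b - e) - a = M - e" "a \<le> b - e + \<nu>" using that a by (auto simp: M_def)
      then show ?thesis using True that by (simp add: F_def)
    next
      case False
      then have "M - e > \<nu>" using that a by (auto simp: M_def)
      then show ?thesis using False p by (simp add: F_def)
    qed
  qed auto
  also have "\<dots> = (\<Sum>\<beta>\<le>b. F \<beta>)"
    by (rule sum.reindex_bij_witness[of _ "\<lambda>\<beta>. b - \<beta>" "\<lambda>\<beta>. b - \<beta>"]) auto
  finally show ?thesis unfolding F_def M_def by (simp add: lessThan_Suc_atMost)
qed

lemma conv_mat_dim [simp]:
  "dim_row (conv_mat g j Q) = (g + j + 1) * dim_row Q"
  "dim_col (conv_mat g j Q) = (j + 1) * dim_col Q"
  by (auto simp: conv_mat_def)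

lemma block_index_less: "a < n \<Longrightarrow> i < p \<Longrightarrow> a * p + i < n * (p::nat)"
proof -
  assume "a < n" "i < p"
  then have "a * p + i < (a + 1) * p" by simp
  also have "\<dots> \<le> n * p" using \<open>a < n\<close> by (intro mult_right_mono) auto
  finally show ?thesis .
qed

lemma conv_mat_carrier:
  "N \<in> carrier_mat t q \<Longrightarrow> conv_mat \<nu> b N \<in> carrier_mat ((\<nu> + b + 1) * t) ((b + 1) * q)"
  by (intro carrier_matI) auto

lemma conv_mat_block:
  assumes Q: "Q \<in> carrier_mat p q" and "a < g + j + 1" "i < p" "\<beta> < j + 1" "k < q"
  shows "conv_mat g j Q $$ (a * p + i, \<beta> * q + k) =
    (if \<beta> \<le> a \<and> a \<le> \<beta> + g then coeff (Q $$ (i, k)) (g + \<beta> - a) else 0)"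
proof -
  have "a * p + i < (g + j + 1) * p" "\<beta> * q + k < (j + 1) * q"
    by (intro block_index_less assms)+
  then show ?thesis using assms by (simp add: conv_mat_def Let_def coeff_mat_def)
qed

lemma conv_mat_0_block:
  assumes Q: "Q \<in> carrier_mat p q" and a: "a < g + 1" "i < p" "k < q"
  shows "conv_mat g 0 Q $$ (a * p + i, k) = coeff (Q $$ (i, k)) (g - a)"
  using conv_mat_block[of Q p q a g 0 i 0 k] assms by simp

lemma block_index_cases:
  fixes x n p :: nat
  assumes "x < n * p"
  obtains a i where "a < n" "i < p" "x = a * p + i"
proof
  have "p > 0" using assms by (cases p) auto
  then show "x div p < n" "x mod p < p" "x = x div p * p + x mod p"
    using assms by (auto simp: less_mult_imp_div_less)
qed

text \<open>Stacking coefficients by \<open>C_0\<close>, multiplication by \<open>N\<close> has the matrix \<open>C_b(N)\<close>.\<close>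

lemma conv_mat_mult:
  fixes N B :: "'a::comm_semiring_0 poly mat"
  assumes N: "N \<in> graded \<nu> t q" and B: "B \<in> graded b q r"
  shows "conv_mat \<nu> b N * conv_mat b 0 B = conv_mat (\<nu> + b) 0 (N * B)"
proof -
  have Nc: "N \<in> carrier_mat t q" and Bc: "B \<in> carrier_mat q r" using N B by (auto simp: graded_iff)
  have NBc: "N * B \<in> carrier_mat t r" using Nc Bc by simp
  show ?thesis
  proof (rule eq_matI)
    fix x c assume "x < dim_row (conv_mat (\<nu> + b) 0 (N * B))" "c < dim_col (conv_mat (\<nu> + b) 0 (N * B))"
    then have x: "x < (\<nu> + b + 1) * t" and c: "c < r" using Nc Bc by auto
    from x obtain a i where ai: "a < \<nu> + b + 1" "i < t" "x = a * t + i" by (rule block_index_cases)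
    have "(conv_mat \<nu> b N * conv_mat b 0 B) $$ (x, c) =
        (\<Sum>\<gamma><(b + 1) * q. conv_mat \<nu> b N $$ (x, \<gamma>) * conv_mat b 0 B $$ (\<gamma>, c))"
      using x c Nc Bc by (simp add: scalar_prod_def atLeast0LessThan)
    also have "\<dots> = (\<Sum>\<beta><b + 1. \<Sum>j<q. conv_mat \<nu> b N $$ (x, \<beta> * q + j) * conv_mat b 0 B $$ (\<beta> * q + j, c))"
      by (rule sum_blocks)
    also have "\<dots> = (\<Sum>\<beta><b + 1. \<Sum>j<q.
        (if \<beta> \<le> a \<and> a \<le> \<beta> + \<nu> then coeff (N $$ (i, j)) (\<nu> + \<beta> - a) else 0) * coeff (B $$ (j, c)) (b - \<beta>))"
    proof (intro sum.cong refl)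
      fix \<beta> j assume "\<beta> \<in> {..<b + 1}" "j \<in> {..<q}"
      then have \<beta>j: "\<beta> < b + 1" "j < q" by auto
      show "conv_mat \<nu> b N $$ (x, \<beta> * q + j) * conv_mat b 0 B $$ (\<beta> * q + j, c) =
        (if \<beta> \<le> a \<and> a \<le> \<beta> + \<nu> then coeff (N $$ (i, j)) (\<nu> + \<beta> - a) else 0) * coeff (B $$ (j, c)) (b - \<beta>)"
        unfolding ai(3) conv_mat_block[OF Nc ai(1,2) \<beta>j] conv_mat_0_block[OF Bc \<beta>j c] ..
    qed
    also have "\<dots> = (\<Sum>j<q. \<Sum>\<beta><b + 1.
        (if \<beta> \<le> a \<and> a \<le> \<beta> + \<nu> then coeff (N $$ (i, j)) (\<nu> + \<beta> - a) else 0) * coeff (B $$ (j, c)) (b - \<beta>))"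
      by (rule sum.swap)
    also have "\<dots> = (\<Sum>j<q. coeff (N $$ (i, j) * B $$ (j, c)) (\<nu> + b - a))"
    proof (rule sum.cong[OF refl])
      fix j assume "j \<in> {..<q}"
      then have j: "j < q" by simp
      show "(\<Sum>\<beta><b + 1. (if \<beta> \<le> a \<and> a \<le> \<beta> + \<nu> then coeff (N $$ (i, j)) (\<nu> + \<beta> - a) else 0) *
          coeff (B $$ (j, c)) (b - \<beta>)) = coeff (N $$ (i, j) * B $$ (j, c)) (\<nu> + b - a)"
        using graded_coeff[OF N ai(2) j] graded_coeff[OF B j c] ai(1)
        by (intro coeff_mult_from_top[symmetric]) auto
    qed
    also have "\<dots> = coeff ((N * B) $$ (i, c)) (\<nu> + b - a)"
      using ai c Nc Bc by (simp add: scalar_prod_def atLeast0LessThan coeff_sum)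
    also have "\<dots> = conv_mat (\<nu> + b) 0 (N * B) $$ (x, c)"
      unfolding ai(3) by (rule conv_mat_0_block[OF NBc ai(1,2) c, symmetric])
    finally show "(conv_mat \<nu> b N * conv_mat b 0 B) $$ (x, c) = conv_mat (\<nu> + b) 0 (N * B) $$ (x, c)" .
  qed (use Nc Bc in auto)
qed

text \<open>The inverse of \<open>C_0\<close> on matrices with \<open>b + 1\<close> block rows of height \<open>p\<close>.\<close>

definition unconv :: "nat \<Rightarrow> nat \<Rightarrow> 'a::comm_monoid_add mat \<Rightarrow> 'a poly mat" where
  "unconv b p M = mat p (dim_col M) (\<lambda>(i, j). \<Sum>e\<le>b. monom (M $$ ((b - e) * p + i, j)) e)"

lemma coeff_unconv:
  assumes "i < p" "j < dim_col M"
  shows "coeff (unconv b p M $$ (i, j)) e = (if e \<le> b then M $$ ((b - e) * p + i, j) else 0)"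
  using assms by (simp add: unconv_def coeff_sum)

lemma unconv_graded: "M \<in> carrier_mat x r \<Longrightarrow> unconv b p M \<in> graded b p r"
  using coeff_unconv[of _ p _ M b] by (auto simp: graded_iff unconv_def)

lemma conv_mat_unconv:
  assumes M: "M \<in> carrier_mat ((b + 1) * p) r"
  shows "conv_mat b 0 (unconv b p M) = M"
proof -
  have c: "unconv b p M \<in> carrier_mat p r" using M by (simp add: unconv_def)
  show ?thesis
  proof (rule eq_matI)
    fix x j assume "x < dim_row M" "j < dim_col M"
    then have x: "x < (b + 1) * p" and j: "j < r" using M by auto
    from x obtain a i where ai: "a < b + 1" "i < p" "x = a * p + i" by (rule block_index_cases)
    show "conv_mat b 0 (unconv b p M) $$ (x, j) = M $$ (x, j)"
      unfolding ai(3) conv_mat_0_block[OF c ai(1,2) j] using coeff_unconv[of i p j M b "b - a"] ai j M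
      by simp
  qed (use c M in auto)
qed

lemma conv_mat_0_inj:
  assumes B: "B \<in> graded b p r" "B' \<in> graded b p r" and eq: "conv_mat b 0 B = conv_mat b 0 B'"
  shows "B = B'"
proof -
  have c: "B \<in> carrier_mat p r" "B' \<in> carrier_mat p r" using B by (auto simp: graded_iff)
  have "coeff (B $$ (i, j)) e = coeff (B' $$ (i, j)) e" if ij: "i < p" "j < r" for i j e
  proof (cases "e \<le> b")
    case True
    have a: "b - e < b + 1" by simp
    show ?thesis
      using arg_cong[OF eq, of "\<lambda>X. X $$ ((b - e) * p + i, j)"] True
      unfolding conv_mat_0_block[OF c(1) a ij] conv_mat_0_block[OF c(2) a ij] by simp
  qed (use B ij in \<open>simp add: graded_coeff[of _ b p r]\<close>)
  then show ?thesis using c by (intro eq_matI poly_eqI) auto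
qed

section \<open>Surjectivity by counting dimensions\<close>

text \<open>The columns of \<open>1 - G C_b(N)\<close> lie in the kernel of \<open>C_b(N)\<close>, so they are the coefficient stacks of
  polynomial vectors annihilated by \<open>N\<close>, and these are combinations of the rows of \<open>K\<close>.\<close>

lemma conv_mat_splitting:
  fixes K N :: "'a::field poly mat"
  assumes KN: "dual_minimal_bases s t q K N" and deg: "row_degrees_eq K \<kappa>" "row_degrees_eq N \<nu>"
    and b: "\<kappa> \<le> b"
    and G: "G \<in> carrier_mat ((b + 1) * q) ((\<nu> + b + 1) * t)"
      "conv_mat \<nu> b N * G * conv_mat \<nu> b N = conv_mat \<nu> b N"
  shows "\<exists>W \<in> carrier_mat ((b - \<kappa> + 1) * s) ((b + 1) * q).
    G * conv_mat \<nu> b N + conv_mat \<kappa> (b - \<kappa>) K\<^sup>T * W = 1\<^sub>m ((b + 1) * q)"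
proof -
  note D = dual_minimal_basesD[OF KN]
  have gK: "K \<in> graded \<kappa> s q" and gN: "N \<in> graded \<nu> t q"
    using D(2,3) deg by (auto intro: row_degrees_graded dest: minimal_basisD(1))
  then have Kc: "K \<in> carrier_mat s q" and Nc: "N \<in> carrier_mat t q" by (auto simp: graded_iff)
  have gKT: "K\<^sup>T \<in> graded \<kappa> q s" using gK by (auto simp: graded_iff)
  define A where "A = conv_mat \<nu> b N"
  define c where "c = (b + 1) * q"
  have A: "A \<in> carrier_mat ((\<nu> + b + 1) * t) c" using Nc by (auto simp: A_def c_def intro: carrier_matI)
  have GA: "G * A \<in> carrier_mat c c" using G(1) A by (simp add: c_def)
  define E where "E = 1\<^sub>m c - G * A"
  have E: "E \<in> carrier_mat c c" unfolding E_def by (rule minus_carrier_mat[OF GA])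
  define B where "B = unconv b q E"
  have gB: "B \<in> graded b q c" unfolding B_def using E by (rule unconv_graded)
  have CB: "conv_mat b 0 B = E" unfolding B_def using E by (intro conv_mat_unconv) (simp add: c_def)
  have "A * E = A * 1\<^sub>m c - A * (G * A)"
    unfolding E_def by (rule mult_minus_distrib_mat[OF A _ GA]) simp
  also have "A * (G * A) = A * G * A"
    by (rule assoc_mult_mat[symmetric]) (use A G in \<open>auto simp: c_def\<close>)
  also have "\<dots> = A" using G(2) by (simp add: A_def)
  also have "A * 1\<^sub>m c - A = 0\<^sub>m ((\<nu> + b + 1) * t) c" using A by auto
  finally have AE: "A * E = 0\<^sub>m ((\<nu> + b + 1) * t) c" .
  have gNB: "N * B \<in> graded (\<nu> + b) t c" by (rule graded_mult[OF gN gB])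
  have g0: "0\<^sub>m t c \<in> graded (\<nu> + b) t c" by (simp add: graded_iff)
  have "conv_mat (\<nu> + b) 0 (N * B) = 0\<^sub>m ((\<nu> + b + 1) * t) c"
    using conv_mat_mult[OF gN gB] AE by (simp add: CB A_def)
  also have "\<dots> = conv_mat (\<nu> + b) 0 (0\<^sub>m t c)"
  proof (rule eq_matI)
    fix x j assume "x < dim_row (conv_mat (\<nu> + b) 0 (0\<^sub>m t c :: 'a poly mat))"
      "j < dim_col (conv_mat (\<nu> + b) 0 (0\<^sub>m t c :: 'a poly mat))"
    then have x: "x < (\<nu> + b + 1) * t" and j: "j < c" by auto
    from x obtain a i where ai: "a < \<nu> + b + 1" "i < t" "x = a * t + i" by (rule block_index_cases)
    have "conv_mat (\<nu> + b) 0 (0\<^sub>m t c :: 'a poly mat) $$ (x, j) = 0"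
      unfolding ai(3) conv_mat_0_block[OF zero_carrier_mat ai(1,2) j] using ai j by simp
    then show "(0\<^sub>m ((\<nu> + b + 1) * t) c :: 'a mat) $$ (x, j) = conv_mat (\<nu> + b) 0 (0\<^sub>m t c) $$ (x, j)"
      using x j by simp
  qed auto
  finally have "N * B = 0\<^sub>m t c" by (rule conv_mat_0_inj[OF gNB g0])
  from kernel_of_dual[OF KN deg(1) gB this b]
  obtain X where X: "X \<in> graded (b - \<kappa>) s c" "B = K\<^sup>T * X" by blast
  then have Xc: "X \<in> carrier_mat s c" by (simp add: graded_iff)
  have "E = conv_mat \<kappa> (b - \<kappa>) K\<^sup>T * conv_mat (b - \<kappa>) 0 X"
    using conv_mat_mult[OF gKT X(1)] b by (simp add: CB[symmetric] X(2))
  then have "G * A + conv_mat \<kappa> (b - \<kappa>) K\<^sup>T * conv_mat (b - \<kappa>) 0 X = G * A + E" by simp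
  also have "\<dots> = 1\<^sub>m c" unfolding E_def by (rule mat_add_diff_cancel[OF one_carrier_mat GA])
  finally show ?thesis
    using Xc by (intro bexI[of _ "conv_mat (b - \<kappa>) 0 X"]) (auto simp: A_def c_def intro: carrier_matI)
qed

text \<open>The splitting factors an identity matrix, here for \<open>b = \<kappa>\<close>; comparing sizes gives the
  inequality.\<close>

lemma dual_degree_le:
  fixes K N :: "'a::field poly mat"
  assumes KN: "dual_minimal_bases s t q K N" and deg: "row_degrees_eq K \<kappa>" "row_degrees_eq N \<nu>"
  shows "\<kappa> * s \<le> \<nu> * t"
proof -
  note D = dual_minimal_basesD[OF KN]
  have c: "conv_mat \<nu> \<kappa> N \<in> carrier_mat ((\<nu> + \<kappa> + 1) * t) ((\<kappa> + 1) * q)"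
    using D(3) by (intro conv_mat_carrier) (rule minimal_basisD(1))
  obtain G where G: "G \<in> carrier_mat ((\<kappa> + 1) * q) ((\<nu> + \<kappa> + 1) * t)"
      "conv_mat \<nu> \<kappa> N * G * conv_mat \<nu> \<kappa> N = conv_mat \<nu> \<kappa> N"
    using generalized_inverse_exists[OF c] by blast
  obtain W where W: "W \<in> carrier_mat (1 * s) ((\<kappa> + 1) * q)"
    "G * conv_mat \<nu> \<kappa> N + conv_mat \<kappa> 0 K\<^sup>T * W = 1\<^sub>m ((\<kappa> + 1) * q)"
    using conv_mat_splitting[OF KN deg order_refl G] by auto
  have L: "conv_mat \<kappa> 0 K\<^sup>T \<in> carrier_mat ((\<kappa> + 1) * q) (1 * s)"
    using conv_mat_carrier[of "K\<^sup>T" q s \<kappa> 0] minimal_basisD(1)[OF D(2)] by simp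
  have "(\<kappa> + 1) * q \<le> (\<nu> + \<kappa> + 1) * t + 1 * s"
    by (rule identity_factor_dimension[OF G(1) L c W])
  then show ?thesis unfolding D(1)[symmetric] by (simp add: algebra_simps)
qed

text \<open>The roles of \<open>K\<close> and \<open>N\<close> can be exchanged in the inequality.\<close>

theorem dual_degree_eq:
  fixes K N :: "'a::field poly mat"
  assumes KN: "dual_minimal_bases s t q K N" and deg: "row_degrees_eq K \<kappa>" "row_degrees_eq N \<nu>"
  shows "\<kappa> * s = \<nu> * t"
  using dual_degree_le[OF KN deg] dual_degree_le[OF dual_minimal_bases_sym[OF KN] deg(2,1)]
  by (rule order_antisym)

text \<open>Equality of the degree sums makes the factors in the splitting square, so they commute. In
  particular any generalized inverse of \<open>C_b(N)\<close> is a right inverse.\<close>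

theorem conv_mat_right_inverse:
  fixes K N :: "'a::field poly mat"
  assumes KN: "dual_minimal_bases s t q K N" and deg: "row_degrees_eq K \<kappa>" "row_degrees_eq N \<nu>"
    and b: "\<kappa> \<le> b"
    and G: "G \<in> carrier_mat ((b + 1) * q) ((\<nu> + b + 1) * t)"
      "conv_mat \<nu> b N * G * conv_mat \<nu> b N = conv_mat \<nu> b N"
  shows "conv_mat \<nu> b N * G = 1\<^sub>m ((\<nu> + b + 1) * t)"
proof -
  note D = dual_minimal_basesD[OF KN]
  have c: "conv_mat \<nu> b N \<in> carrier_mat ((\<nu> + b + 1) * t) ((b + 1) * q)"
    using D(3) by (intro conv_mat_carrier) (rule minimal_basisD(1))
  obtain W where W: "W \<in> carrier_mat ((b - \<kappa> + 1) * s) ((b + 1) * q)"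
    "G * conv_mat \<nu> b N + conv_mat \<kappa> (b - \<kappa>) K\<^sup>T * W = 1\<^sub>m ((b + 1) * q)"
    using conv_mat_splitting[OF KN deg b G] by auto
  have L: "conv_mat \<kappa> (b - \<kappa>) K\<^sup>T \<in> carrier_mat ((b + 1) * q) ((b - \<kappa> + 1) * s)"
    using conv_mat_carrier[of "K\<^sup>T" q s \<kappa> "b - \<kappa>"] minimal_basisD(1)[OF D(2)] b by simp
  obtain h where h: "b = \<kappa> + h" using b le_Suc_ex by blast
  have "(b + 1) * q = (\<nu> + b + 1) * t + (b - \<kappa> + 1) * s"
    using dual_degree_eq[OF KN deg] unfolding D(1)[symmetric] h by (simp add: algebra_simps)
  from paired_factors_of_identity[OF G(1) L c W(1) this] W(2) show ?thesis by blast
qed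

section \<open>Solution operators\<close>

text \<open>The solution of \<open>N B = R\<close> selected by a right inverse \<open>G\<close> of the convolution matrix of \<open>N\<close>, where
  \<open>g\<close> is the grade of \<open>R\<close> and \<open>b\<close> that of \<open>B\<close>. The minimum norm solution is the case of the
  Moore--Penrose inverse; other choices of \<open>G\<close> exist over every field.\<close>

definition conv_solve :: "nat \<Rightarrow> nat \<Rightarrow> nat \<Rightarrow> 'a::semiring_0 mat \<Rightarrow> 'a poly mat \<Rightarrow> 'a poly mat" where
  "conv_solve g b q G R = unconv b q (G * conv_mat g 0 R)"

lemma conv_solve_graded:
  assumes "R \<in> carrier_mat t r"
  shows "conv_solve g b q G R \<in> graded b q r"
  unfolding conv_solve_def using assms
  by (intro unconv_graded[of _ "dim_row G"] carrier_matI) auto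

lemma conv_solve_solves:
  fixes N :: "'a::field poly mat"
  assumes N: "N \<in> graded \<nu> t q"
    and G: "G \<in> carrier_mat ((b + 1) * q) ((\<nu> + b + 1) * t)"
      "conv_mat \<nu> b N * G = 1\<^sub>m ((\<nu> + b + 1) * t)"
    and R: "R \<in> graded (\<nu> + b) t r"
  shows "N * conv_solve (\<nu> + b) b q G R = R"
proof (rule conv_mat_0_inj[OF _ R])
  have Rc: "R \<in> carrier_mat t r" by (rule graded_carrier[OF R])
  note S = conv_solve_graded[OF Rc, of "\<nu> + b" b q G]
  show "N * conv_solve (\<nu> + b) b q G R \<in> graded (\<nu> + b) t r" by (rule graded_mult[OF N S])
  have C: "conv_mat (\<nu> + b) 0 R \<in> carrier_mat ((\<nu> + b + 1) * t) r"
    using conv_mat_carrier[OF Rc, of "\<nu> + b" 0] by simp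
  have A: "conv_mat \<nu> b N \<in> carrier_mat ((\<nu> + b + 1) * t) ((b + 1) * q)"
    by (rule conv_mat_carrier[OF graded_carrier[OF N]])
  have "conv_mat (\<nu> + b) 0 (N * conv_solve (\<nu> + b) b q G R) =
      conv_mat \<nu> b N * conv_mat b 0 (conv_solve (\<nu> + b) b q G R)"
    by (rule conv_mat_mult[OF N S, symmetric])
  also have "\<dots> = conv_mat \<nu> b N * (G * conv_mat (\<nu> + b) 0 R)"
    unfolding conv_solve_def by (subst conv_mat_unconv[OF mult_carrier_mat[OF G(1) C]]) (rule refl)
  also have "\<dots> = conv_mat \<nu> b N * G * conv_mat (\<nu> + b) 0 R"
    by (rule assoc_mult_mat[OF A G(1) C, symmetric])
  also have "\<dots> = conv_mat (\<nu> + b) 0 R" unfolding G(2) by (rule left_mult_one_mat[OF C])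
  finally show "conv_mat (\<nu> + b) 0 (N * conv_solve (\<nu> + b) b q G R) = conv_mat (\<nu> + b) 0 R" .
qed

lemma min_norm_sol_eq_conv_solve:
  fixes N :: "'a::field poly mat"
  assumes N: "N \<in> carrier_mat t q" and R: "R \<in> carrier_mat t r"
    and G: "mp_inverse \<sigma> (conv_mat \<nu> b N) \<in> carrier_mat ((b + 1) * q) ((\<nu> + b + 1) * t)"
  shows "min_norm_sol \<sigma> \<nu> b N R = conv_solve (\<nu> + b) b q (mp_inverse \<sigma> (conv_mat \<nu> b N)) R"
    (is "_ = ?S")
  unfolding min_norm_sol_def
proof (rule the_equality)
  have C: "conv_mat (\<nu> + b) 0 R \<in> carrier_mat ((\<nu> + b + 1) * t) r"
    using conv_mat_carrier[OF R, of "\<nu> + b" 0] by simp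
  have S: "?S \<in> graded b (dim_col N) (dim_col R)"
    using conv_solve_graded[OF R, of "\<nu> + b" b q] N R by simp
  moreover have CS: "conv_mat b 0 ?S = mp_inverse \<sigma> (conv_mat \<nu> b N) * conv_mat (\<nu> + b) 0 R"
    unfolding conv_solve_def by (rule conv_mat_unconv[OF mult_carrier_mat[OF G C]])
  ultimately show "?S \<in> graded b (dim_col N) (dim_col R) \<and>
      conv_mat b 0 ?S = mp_inverse \<sigma> (conv_mat \<nu> b N) * conv_mat (\<nu> + b) 0 R" ..
  fix B assume "B \<in> graded b (dim_col N) (dim_col R) \<and>
    conv_mat b 0 B = mp_inverse \<sigma> (conv_mat \<nu> b N) * conv_mat (\<nu> + b) 0 R"
  then show "B = ?S" using S CS by (intro conv_mat_0_inj[of B b "dim_col N" "dim_col R"]) simp_all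
qed

section \<open>The solution set of the two-sided equation\<close>

text \<open>The right inverses \<open>G1\<close> and \<open>G2\<close> are left open: generalized inverses give existence and the
  parameter count over an arbitrary field, Moore--Penrose inverses give the minimum norm
  representation.\<close>

locale dual_pairs =
  fixes K1 N1 K2 N2 :: "'a::field poly mat"
    and m n m1 m2 l \<epsilon> \<eta> :: nat
    and G1 G2 :: "'a mat"
  assumes dual1: "dual_minimal_bases m1 n (n + m1) K1 N1"
    and dual2: "dual_minimal_bases m2 m (m + m2) K2 N2"
    and deg: "row_degrees_eq K1 l" "row_degrees_eq K2 l" "row_degrees_eq N1 \<epsilon>" "row_degrees_eq N2 \<eta>"
    and G1: "G1 \<in> carrier_mat ((l + 1) * (n + m1)) ((\<epsilon> + l + 1) * n)"
      "conv_mat \<epsilon> l N1 * G1 = 1\<^sub>m ((\<epsilon> + l + 1) * n)"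
    and G2: "G2 \<in> carrier_mat ((l + \<epsilon> + 1) * (m + m2)) ((\<eta> + (l + \<epsilon>) + 1) * m)"
      "conv_mat \<eta> (l + \<epsilon>) N2 * G2 = 1\<^sub>m ((\<eta> + (l + \<epsilon>) + 1) * m)"
begin

abbreviation "S1 \<equiv> conv_solve (\<epsilon> + l) l (n + m1) G1"
abbreviation "S2 \<equiv> conv_solve (\<eta> + (l + \<epsilon>)) (l + \<epsilon>) (m + m2) G2"

abbreviation sols :: "'a poly mat \<Rightarrow> 'a poly mat set" where
  "sols P \<equiv> {M \<in> graded l (m + m2) (n + m1). N2 * M * N1\<^sup>T = P}"

definition sol :: "'a poly mat \<Rightarrow> 'a poly mat \<Rightarrow> 'a poly mat \<Rightarrow> 'a poly mat" where
  "sol P X Y = (S1 ((S2 P)\<^sup>T))\<^sup>T + (S1 (X\<^sup>T * K2))\<^sup>T + Y\<^sup>T * K1"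

lemma graded_bases:
  "K1 \<in> graded l m1 (n + m1)" "N1 \<in> graded \<epsilon> n (n + m1)"
  "K2 \<in> graded l m2 (m + m2)" "N2 \<in> graded \<eta> m (m + m2)"
  using dual_minimal_basesD(2,3)[OF dual1] dual_minimal_basesD(2,3)[OF dual2]
  by (auto intro: row_degrees_graded deg dest: minimal_basisD(1))

lemmas carrier_bases = graded_bases[THEN graded_carrier]

lemma S2_props:
  assumes P: "P \<in> graded (\<eta> + (l + \<epsilon>)) m n"
  shows "S2 P \<in> graded (l + \<epsilon>) (m + m2) n" "N2 * S2 P = P"
  using conv_solve_graded[OF graded_carrier[OF P]] conv_solve_solves[OF graded_bases(4) G2 P] by auto

lemma S1_props:
  assumes R: "R \<in> graded (l + \<epsilon>) (m + m2) n"
  shows "(S1 (R\<^sup>T))\<^sup>T \<in> graded l (m + m2) (n + m1)" "(S1 (R\<^sup>T))\<^sup>T * N1\<^sup>T = R"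
proof -
  have RT: "R\<^sup>T \<in> graded (\<epsilon> + l) n (m + m2)" using graded_transpose[OF R] by (simp add: add.commute)
  have S: "S1 (R\<^sup>T) \<in> graded l (n + m1) (m + m2)"
    by (rule conv_solve_graded[OF graded_carrier[OF RT]])
  show "(S1 (R\<^sup>T))\<^sup>T \<in> graded l (m + m2) (n + m1)" by (rule graded_transpose[OF S])
  have "(S1 (R\<^sup>T))\<^sup>T * N1\<^sup>T = (N1 * S1 (R\<^sup>T))\<^sup>T"
    by (rule transpose_mult[OF carrier_bases(2) graded_carrier[OF S], symmetric])
  also have "\<dots> = R" unfolding conv_solve_solves[OF graded_bases(2) G1 RT] by simp
  finally show "(S1 (R\<^sup>T))\<^sup>T * N1\<^sup>T = R" .
qed

lemma K2_mult_graded: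
  assumes X: "X \<in> graded \<epsilon> m2 n"
  shows "K2\<^sup>T * X \<in> graded (l + \<epsilon>) (m + m2) n" "X\<^sup>T * K2 = (K2\<^sup>T * X)\<^sup>T"
proof -
  show "K2\<^sup>T * X \<in> graded (l + \<epsilon>) (m + m2) n"
    by (rule graded_mult[OF graded_transpose[OF graded_bases(3)] X])
  have "K2\<^sup>T \<in> carrier_mat (m + m2) m2" using carrier_bases(3) by simp
  from transpose_mult[OF this graded_carrier[OF X]] show "X\<^sup>T * K2 = (K2\<^sup>T * X)\<^sup>T" by simp
qed

text \<open>Multiplication by \<open>N1\<^sup>T\<close> undoes \<open>S1\<close> and annihilates \<open>Y\<^sup>T K1\<close>, so it exposes \<open>X\<close>.\<close>

lemma sol_props:
  assumes P: "P \<in> graded (\<eta> + (l + \<epsilon>)) m n" and X: "X \<in> graded \<epsilon> m2 n"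
    and Y: "Y \<in> graded 0 m1 (m + m2)"
  shows "sol P X Y \<in> graded l (m + m2) (n + m1)" "sol P X Y * N1\<^sup>T = S2 P + K2\<^sup>T * X"
proof -
  note A = S1_props[OF S2_props(1)[OF P]]
  note B = S1_props[OF K2_mult_graded(1)[OF X], folded K2_mult_graded(2)[OF X]]
  have C: "Y\<^sup>T * K1 \<in> graded l (m + m2) (n + m1)"
    using graded_mult[OF graded_transpose[OF Y] graded_bases(1)] by simp
  show "sol P X Y \<in> graded l (m + m2) (n + m1)"
    unfolding sol_def by (intro graded_add A B C)
  note AC = A(1)[THEN graded_carrier] and BC = B(1)[THEN graded_carrier] and CC = C[THEN graded_carrier]
  have NT: "N1\<^sup>T \<in> carrier_mat (n + m1) n" using carrier_bases(2) by simp
  have YT: "Y\<^sup>T \<in> carrier_mat (m + m2) m1" using graded_carrier[OF Y] by simp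
  have "Y\<^sup>T * K1 * N1\<^sup>T = 0\<^sub>m (m + m2) n"
    unfolding assoc_mult_mat[OF YT carrier_bases(1) NT] dual_minimal_basesD(4)[OF dual1]
    by (rule right_mult_zero_mat[OF YT])
  then have "sol P X Y * N1\<^sup>T = S2 P + K2\<^sup>T * X + 0\<^sub>m (m + m2) n"
    unfolding sol_def add_mult_distrib_mat[OF add_carrier_mat[OF BC] CC NT]
      add_mult_distrib_mat[OF AC BC NT] A(2) B(2) by simp
  then show "sol P X Y * N1\<^sup>T = S2 P + K2\<^sup>T * X"
    using right_add_zero_mat[OF add_carrier_mat[OF graded_carrier[OF K2_mult_graded(1)[OF X]]]] by simp
qed

lemma sol_in_sols:
  assumes P: "P \<in> graded (\<eta> + (l + \<epsilon>)) m n" and X: "X \<in> graded \<epsilon> m2 n"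
    and Y: "Y \<in> graded 0 m1 (m + m2)"
  shows "sol P X Y \<in> sols P"
proof -
  note S = sol_props[OF P X Y]
  have NT: "N1\<^sup>T \<in> carrier_mat (n + m1) n" using carrier_bases(2) by simp
  have KT: "K2\<^sup>T \<in> carrier_mat (m + m2) m2" using carrier_bases(3) by simp
  note SP = S2_props[OF P] and Xc = graded_carrier[OF X]
  have "N2 * sol P X Y * N1\<^sup>T = N2 * (S2 P + K2\<^sup>T * X)"
    using assoc_mult_mat[OF carrier_bases(4) graded_carrier[OF S(1)] NT] S(2) by simp
  also have "\<dots> = N2 * S2 P + N2 * (K2\<^sup>T * X)"
    by (rule mult_add_distrib_mat[OF carrier_bases(4) graded_carrier[OF SP(1)] mult_carrier_mat[OF KT Xc]])
  also have "N2 * (K2\<^sup>T * X) = 0\<^sub>m m n"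
    unfolding assoc_mult_mat[OF carrier_bases(4) KT Xc, symmetric] dual_minimal_basesD(5)[OF dual2]
    by (rule left_mult_zero_mat[OF Xc])
  also have "N2 * S2 P + 0\<^sub>m m n = P" using graded_carrier[OF P] by (simp add: SP(2))
  finally show ?thesis using S(1) by simp
qed

text \<open>The kernel of \<open>N2\<close> determines \<open>X\<close> from \<open>M N1\<^sup>T - S2 P\<close>; what then remains of \<open>M\<close> is annihilated by
  \<open>N1\<^sup>T\<close>, and has grade \<open>l\<close>, so the kernel of \<open>N1\<close> provides a \<open>Y\<close> of grade \<open>l - l = 0\<close>.\<close>

lemma sol_surj:
  assumes P: "P \<in> graded (\<eta> + (l + \<epsilon>)) m n" and M: "M \<in> sols P"
  shows "\<exists>X \<in> graded \<epsilon> m2 n. \<exists>Y \<in> graded 0 m1 (m + m2). M = sol P X Y"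
proof -
  have gM: "M \<in> graded l (m + m2) (n + m1)" and MP: "N2 * M * N1\<^sup>T = P" using M by auto
  note Mc = graded_carrier[OF gM] and SP = S2_props[OF P]
  have gNT: "N1\<^sup>T \<in> graded \<epsilon> (n + m1) n" by (rule graded_transpose[OF graded_bases(2)])
  note NT = graded_carrier[OF gNT]
  have gZ: "M * N1\<^sup>T \<in> graded (l + \<epsilon>) (m + m2) n" by (rule graded_mult[OF gM gNT])
  have gD: "M * N1\<^sup>T - S2 P \<in> graded (l + \<epsilon>) (m + m2) n" by (rule graded_diff[OF gZ SP(1)])
  have "N2 * (M * N1\<^sup>T - S2 P) = N2 * (M * N1\<^sup>T) - N2 * S2 P"
    by (rule mult_minus_distrib_mat[OF carrier_bases(4) graded_carrier[OF gZ] graded_carrier[OF SP(1)]])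
  also have "\<dots> = 0\<^sub>m m n"
    unfolding assoc_mult_mat[OF carrier_bases(4) Mc NT, symmetric] MP SP(2)
    by (rule minus_r_inv_mat[OF graded_carrier[OF P]])
  finally have "N2 * (M * N1\<^sup>T - S2 P) = 0\<^sub>m m n" .
  from kernel_of_dual[OF dual2 deg(2) gD this]
  obtain X where X: "X \<in> graded \<epsilon> m2 n" "M * N1\<^sup>T - S2 P = K2\<^sup>T * X" by auto
  \<comment> \<open>Subtracting the solution with \<open>Y = 0\<close> leaves the part annihilated by \<open>N1\<^sup>T\<close>.\<close>
  have g0: "0\<^sub>m m1 (m + m2) \<in> graded 0 m1 (m + m2)" by (simp add: graded_iff)
  note T = sol_props[OF P X(1) g0]
  define E where "E = M - sol P X (0\<^sub>m m1 (m + m2))"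
  have gE: "E \<in> graded l (m + m2) (n + m1)" unfolding E_def by (rule graded_diff[OF gM T(1)])
  have "E * N1\<^sup>T = M * N1\<^sup>T - (S2 P + (M * N1\<^sup>T - S2 P))"
    unfolding E_def minus_mult_distrib_mat[OF Mc graded_carrier[OF T(1)] NT] T(2) X(2) ..
  also have "\<dots> = 0\<^sub>m (m + m2) n"
    unfolding mat_add_diff_cancel[OF graded_carrier[OF gZ] graded_carrier[OF SP(1)]]
    by (rule minus_r_inv_mat[OF graded_carrier[OF gZ]])
  finally have "(E * N1\<^sup>T)\<^sup>T = 0\<^sub>m n (m + m2)" by simp
  then have "N1 * E\<^sup>T = 0\<^sub>m n (m + m2)"
    using transpose_mult[OF graded_carrier[OF gE] NT] by simp
  from kernel_of_dual[OF dual1 deg(1) graded_transpose[OF gE] this order_refl]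
  obtain Y where Y: "Y \<in> graded 0 m1 (m + m2)" "E\<^sup>T = K1\<^sup>T * Y" by auto
  have KT: "K1\<^sup>T \<in> carrier_mat (n + m1) m1" using carrier_bases(1) by simp
  have EY: "E = Y\<^sup>T * K1"
    using arg_cong[OF Y(2), of transpose_mat] transpose_mult[OF KT graded_carrier[OF Y(1)]] by simp
  have z: "(0\<^sub>m m1 (m + m2))\<^sup>T * K1 = 0\<^sub>m (m + m2) (n + m1)"
    using carrier_bases(1) by simp
  note A = S1_props(1)[OF SP(1), THEN graded_carrier]
  note B = S1_props(1)[OF K2_mult_graded(1)[OF X(1)], folded K2_mult_graded(2)[OF X(1)], THEN graded_carrier]
  have "sol P X (0\<^sub>m m1 (m + m2)) = (S1 ((S2 P)\<^sup>T))\<^sup>T + (S1 (X\<^sup>T * K2))\<^sup>T"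
    unfolding sol_def z by (rule right_add_zero_mat[OF add_carrier_mat[OF B]])
  then have "sol P X Y = sol P X (0\<^sub>m m1 (m + m2)) + E"
    unfolding EY by (simp add: sol_def)
  also have "\<dots> = M"
    unfolding E_def by (rule mat_add_diff_cancel[OF Mc graded_carrier[OF T(1)]])
  finally show ?thesis using X(1) Y(1) by blast
qed

lemma sol_inj:
  assumes P: "P \<in> graded (\<eta> + (l + \<epsilon>)) m n"
    and X: "X \<in> graded \<epsilon> m2 n" "X' \<in> graded \<epsilon> m2 n"
    and Y: "Y \<in> graded 0 m1 (m + m2)" "Y' \<in> graded 0 m1 (m + m2)"
    and eq: "sol P X Y = sol P X' Y'"
  shows "X = X' \<and> Y = Y'"
proof
  have "S2 P + K2\<^sup>T * X = S2 P + K2\<^sup>T * X'"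
    using sol_props(2)[OF P X(1) Y(1)] sol_props(2)[OF P X(2) Y(2)] eq by simp
  then have "K2\<^sup>T * X = K2\<^sup>T * X'"
    by (rule mat_add_left_cancel[OF graded_carrier[OF S2_props(1)[OF P]]
      graded_carrier[OF K2_mult_graded(1)[OF X(1)]] graded_carrier[OF K2_mult_graded(1)[OF X(2)]]])
  then show XX: "X = X'"
    by (rule minimal_basis_mult_inj[OF dual_minimal_basesD(2)[OF dual2] X[THEN graded_carrier]])
  note B = S1_props(1)[OF K2_mult_graded(1)[OF X(1)], folded K2_mult_graded(2)[OF X(1)], THEN graded_carrier]
  have Yc: "Y \<in> carrier_mat m1 (m + m2)" "Y' \<in> carrier_mat m1 (m + m2)"
    using Y by (auto dest: graded_carrier)
  have "Y\<^sup>T * K1 \<in> carrier_mat (m + m2) (n + m1)" "Y'\<^sup>T * K1 \<in> carrier_mat (m + m2) (n + m1)"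
    using Yc carrier_bases(1) by auto
  from mat_add_left_cancel[OF add_carrier_mat[OF B] this]
  have eq': "Y\<^sup>T * K1 = Y'\<^sup>T * K1" using eq unfolding XX sol_def by blast
  have YT: "Y\<^sup>T \<in> carrier_mat (m + m2) m1" "Y'\<^sup>T \<in> carrier_mat (m + m2) m1" using Yc by auto
  have "K1\<^sup>T * Y = K1\<^sup>T * Y'"
    using arg_cong[OF eq', of transpose_mat] transpose_mult[OF YT(1) carrier_bases(1)]
      transpose_mult[OF YT(2) carrier_bases(1)] by simp
  then show "Y = Y'"
    by (rule minimal_basis_mult_inj[OF dual_minimal_basesD(2)[OF dual1] Yc])
qed

end

section \<open>Counting parameters\<close>

text \<open>A linear map into polynomials, given by the images of the unit vectors. Linearity of a matrix valued
  map is stated entry by entry because this form passes through each operation that builds a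
  solution from its parameters.\<close>

definition linear_entry :: "nat \<Rightarrow> ('a::field vec \<Rightarrow> 'a poly) \<Rightarrow> bool" where
  "linear_entry k \<phi> \<longleftrightarrow> (\<exists>v. \<forall>c \<in> carrier_vec k. \<phi> c = (\<Sum>t<k. Polynomial.smult (c $ t) (v t)))"

definition linear_mat :: "nat \<Rightarrow> nat \<Rightarrow> nat \<Rightarrow> ('a::field vec \<Rightarrow> 'a poly mat) \<Rightarrow> bool" where
  "linear_mat k p q F \<longleftrightarrow> (\<forall>c \<in> carrier_vec k. F c \<in> carrier_mat p q) \<and>
     (\<forall>i<p. \<forall>j<q. linear_entry k (\<lambda>c. F c $$ (i, j)))"

lemma linear_entry_cong:
  assumes "linear_entry k \<phi>" "\<And>c. c \<in> carrier_vec k \<Longrightarrow> \<psi> c = \<phi> c"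
  shows "linear_entry k \<psi>"
  using assms by (simp add: linear_entry_def)

lemma linear_entry_coord:
  assumes "t < k"
  shows "linear_entry k (\<lambda>c. monom (c $ t) e)"
proof -
  have "monom (c $ t) e = (\<Sum>t'<k. Polynomial.smult (c $ t') (if t' = t then monom 1 e else 0))" for c :: "'a vec"
  proof -
    have "(\<Sum>t'<k. Polynomial.smult (c $ t') (if t' = t then monom 1 e else 0)) =
        (\<Sum>t'<k. if t' = t then monom (c $ t') e else 0)"
      by (rule sum.cong) (auto simp: smult_monom)
    then show ?thesis using assms by simp
  qed
  then show ?thesis
    unfolding linear_entry_def by (intro exI[of _ "\<lambda>t'. if t' = t then monom 1 e else 0"]) blast
qed

lemma linear_entry_sum:
  assumes "\<And>i. i \<in> I \<Longrightarrow> linear_entry k (\<phi> i)"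
  shows "linear_entry k (\<lambda>c. \<Sum>i\<in>I. \<phi> i c)"
proof -
  from assms obtain v where v: "\<And>i c. i \<in> I \<Longrightarrow> c \<in> carrier_vec k \<Longrightarrow>
      \<phi> i c = (\<Sum>t<k. Polynomial.smult (c $ t) (v i t))"
    unfolding linear_entry_def by metis
  have "(\<Sum>i\<in>I. \<phi> i c) = (\<Sum>t<k. Polynomial.smult (c $ t) (\<Sum>i\<in>I. v i t))" if "c \<in> carrier_vec k" for c
  proof -
    have "(\<Sum>i\<in>I. \<phi> i c) = (\<Sum>i\<in>I. \<Sum>t<k. Polynomial.smult (c $ t) (v i t))"
      using v that by (intro sum.cong) auto
    also have "\<dots> = (\<Sum>t<k. \<Sum>i\<in>I. Polynomial.smult (c $ t) (v i t))" by (rule sum.swap)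
    also have "\<dots> = (\<Sum>t<k. Polynomial.smult (c $ t) (\<Sum>i\<in>I. v i t))"
      by (intro sum.cong refl poly_eqI) (simp add: coeff_sum sum_distrib_left)
    finally show ?thesis .
  qed
  then show ?thesis unfolding linear_entry_def by (intro exI[of _ "\<lambda>t. \<Sum>i\<in>I. v i t"]) blast
qed

lemma linear_entry_mult:
  assumes "linear_entry k \<phi>"
  shows "linear_entry k (\<lambda>c. p * \<phi> c)"
proof -
  obtain v where v: "\<And>c. c \<in> carrier_vec k \<Longrightarrow> \<phi> c = (\<Sum>t<k. Polynomial.smult (c $ t) (v t))"
    using assms unfolding linear_entry_def by blast
  show ?thesis
    unfolding linear_entry_def by (rule exI[of _ "\<lambda>t. p * v t"]) (simp add: v sum_distrib_left)
qed

lemma linear_entry_coeff: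
  assumes "linear_entry k \<phi>"
  shows "linear_entry k (\<lambda>c. monom (a * coeff (\<phi> c) e) f)"
proof -
  obtain v where v: "\<And>c. c \<in> carrier_vec k \<Longrightarrow> \<phi> c = (\<Sum>t<k. Polynomial.smult (c $ t) (v t))"
    using assms unfolding linear_entry_def by blast
  have "monom (a * coeff (\<phi> c) e) f = (\<Sum>t<k. Polynomial.smult (c $ t) (monom (a * coeff (v t) e) f))"
    if "c \<in> carrier_vec k" for c
  proof (rule poly_eqI)
    fix n
    show "coeff (monom (a * coeff (\<phi> c) e) f) n =
        coeff (\<Sum>t<k. Polynomial.smult (c $ t) (monom (a * coeff (v t) e) f)) n"
      by (cases "n = f") (simp_all add: v[OF that] coeff_sum sum_distrib_left mult.left_commute)
  qed
  then show ?thesis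
    unfolding linear_entry_def by (intro exI[of _ "\<lambda>t. monom (a * coeff (v t) e) f"]) blast
qed

lemma linear_mat_transpose:
  "linear_mat k p q F \<Longrightarrow> linear_mat k q p (\<lambda>c. (F c)\<^sup>T)"
  unfolding linear_mat_def by (auto intro!: linear_entry_cong[where \<psi> = "\<lambda>c. (F c)\<^sup>T $$ _"])

lemma linear_mat_add:
  assumes F: "linear_mat k p q F" and H: "linear_mat k p q H"
  shows "linear_mat k p q (\<lambda>c. F c + H c)"
proof -
  have "linear_entry k (\<lambda>c. (F c + H c) $$ (i, j))" if "i < p" "j < q" for i j
  proof (rule linear_entry_cong)
    \<comment> \<open>The binary sum is a sum over a set of two indices.\<close>
    have "linear_entry k (\<lambda>c. if b then F c $$ (i, j) else H c $$ (i, j))" for b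
      using F H that by (cases b) (auto simp: linear_mat_def)
    then show "linear_entry k (\<lambda>c. \<Sum>b\<in>{True, False}. if b then F c $$ (i, j) else H c $$ (i, j))"
      by (intro linear_entry_sum)
    show "(F c + H c) $$ (i, j) = (\<Sum>b\<in>{True, False}. if b then F c $$ (i, j) else H c $$ (i, j))"
      if "c \<in> carrier_vec k" for c
      using F H that \<open>i < p\<close> \<open>j < q\<close> by (auto simp: linear_mat_def)
  qed
  then show ?thesis using F H by (simp add: linear_mat_def)
qed

lemma linear_mat_mult:
  assumes F: "linear_mat k p q F" and Q: "Q \<in> carrier_mat q r"
  shows "linear_mat k p r (\<lambda>c. F c * Q)"
proof -
  have "linear_entry k (\<lambda>c. (F c * Q) $$ (i, j))" if "i < p" "j < r" for i j
  proof (rule linear_entry_cong)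
    show "linear_entry k (\<lambda>c. \<Sum>x<q. Q $$ (x, j) * F c $$ (i, x))"
      using F that by (intro linear_entry_sum linear_entry_mult) (auto simp: linear_mat_def)
    show "(F c * Q) $$ (i, j) = (\<Sum>x<q. Q $$ (x, j) * F c $$ (i, x))" if "c \<in> carrier_vec k" for c
      using F that \<open>i < p\<close> \<open>j < r\<close> Q
      by (auto simp: linear_mat_def scalar_prod_def atLeast0LessThan mult.commute)
  qed
  then show ?thesis using F Q by (auto simp: linear_mat_def)
qed

text \<open>The operator written out in the coefficients of \<open>R\<close>, which shows that it preserves linearity.\<close>

lemma conv_solve_index:
  assumes G: "G \<in> carrier_mat ((b + 1) * q) ((g + 1) * t)" and R: "R \<in> carrier_mat t r"
    and ij: "i < q" "j < r"
  shows "conv_solve g b q G R $$ (i, j) =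
    (\<Sum>e\<le>b. \<Sum>a<g + 1. \<Sum>x<t. monom (G $$ ((b - e) * q + i, a * t + x) * coeff (R $$ (x, j)) (g - a)) e)"
proof (rule poly_eqI)
  fix f
  have "coeff (conv_solve g b q G R $$ (i, j)) f =
      (if f \<le> b then (G * conv_mat g 0 R) $$ ((b - f) * q + i, j) else 0)"
    unfolding conv_solve_def using R ij by (intro coeff_unconv) auto
  also have "\<dots> = (if f \<le> b then (\<Sum>a<g + 1. \<Sum>x<t. G $$ ((b - f) * q + i, a * t + x) * coeff (R $$ (x, j)) (g - a)) else 0)"
  proof (cases "f \<le> b")
    case True
    have row: "(b - f) * q + i < (b + 1) * q" using ij by (intro block_index_less) auto
    have "(G * conv_mat g 0 R) $$ ((b - f) * q + i, j) =
        (\<Sum>\<gamma><(g + 1) * t. G $$ ((b - f) * q + i, \<gamma>) * conv_mat g 0 R $$ (\<gamma>, j))"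
      using row G R ij by (simp add: scalar_prod_def atLeast0LessThan)
    also have "\<dots> = (\<Sum>a<g + 1. \<Sum>x<t. G $$ ((b - f) * q + i, a * t + x) * conv_mat g 0 R $$ (a * t + x, j))"
      by (rule sum_blocks)
    also have "\<dots> = (\<Sum>a<g + 1. \<Sum>x<t. G $$ ((b - f) * q + i, a * t + x) * coeff (R $$ (x, j)) (g - a))"
      by (intro sum.cong refl arg_cong2[of _ _ _ _ "(*)"] conv_mat_0_block[OF R _ _ ij(2)]) auto
    finally show ?thesis using True by simp
  qed simp
  also have "\<dots> = (\<Sum>e\<le>b. if e = f then
      (\<Sum>a<g + 1. \<Sum>x<t. G $$ ((b - e) * q + i, a * t + x) * coeff (R $$ (x, j)) (g - a)) else 0)"
    by (simp del: sum.lessThan_Suc)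
  also have "\<dots> = (\<Sum>e\<le>b. \<Sum>a<g + 1. \<Sum>x<t.
      coeff (monom (G $$ ((b - e) * q + i, a * t + x) * coeff (R $$ (x, j)) (g - a)) e) f)"
    by (rule sum.cong) (auto simp del: sum.lessThan_Suc)
  finally show "coeff (conv_solve g b q G R $$ (i, j)) f = coeff (\<Sum>e\<le>b. \<Sum>a<g + 1. \<Sum>x<t.
      monom (G $$ ((b - e) * q + i, a * t + x) * coeff (R $$ (x, j)) (g - a)) e) f"
    by (simp only: coeff_sum)
qed

lemma linear_mat_conv_solve:
  assumes F: "linear_mat k t r F" and G: "G \<in> carrier_mat ((b + 1) * q) ((g + 1) * t)"
  shows "linear_mat k q r (\<lambda>c. conv_solve g b q G (F c))"
proof -
  have "linear_entry k (\<lambda>c. conv_solve g b q G (F c) $$ (i, j))" if "i < q" "j < r" for i j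
  proof (rule linear_entry_cong)
    show "linear_entry k (\<lambda>c. \<Sum>e\<le>b. \<Sum>a<g + 1. \<Sum>x<t.
        monom (G $$ ((b - e) * q + i, a * t + x) * coeff (F c $$ (x, j)) (g - a)) e)"
      using F that by (intro linear_entry_sum linear_entry_coeff) (auto simp: linear_mat_def)
    show "conv_solve g b q G (F c) $$ (i, j) = (\<Sum>e\<le>b. \<Sum>a<g + 1. \<Sum>x<t.
        monom (G $$ ((b - e) * q + i, a * t + x) * coeff (F c $$ (x, j)) (g - a)) e)"
      if "c \<in> carrier_vec k" for c
      using F that \<open>i < q\<close> \<open>j < r\<close> by (intro conv_solve_index[OF G]) (auto simp: linear_mat_def)
  qed
  moreover have "conv_solve g b q G (F c) \<in> carrier_mat q r" if "c \<in> carrier_vec k" for c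
    using F that by (intro graded_carrier[OF conv_solve_graded]) (auto simp: linear_mat_def)
  ultimately show ?thesis by (simp add: linear_mat_def)
qed

text \<open>The polynomial matrix of grade \<open>b\<close> whose coefficients are listed in \<open>c\<close> from position \<open>a\<close> on. The
  offset allows one vector of parameters to hold first \<open>X\<close> and then \<open>Y\<close>.\<close>

definition poly_mat_of_vec :: "nat \<Rightarrow> nat \<Rightarrow> nat \<Rightarrow> nat \<Rightarrow> 'a::field vec \<Rightarrow> 'a poly mat" where
  "poly_mat_of_vec a b p q c = mat p q (\<lambda>(i, j). \<Sum>e\<le>b. monom (c $ (a + ((e * p + i) * q + j))) e)"

lemma coeff_poly_mat_of_vec:
  assumes "i < p" "j < q"
  shows "coeff (poly_mat_of_vec a b p q c $$ (i, j)) e = (if e \<le> b then c $ (a + ((e * p + i) * q + j)) else 0)"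
  using assms by (simp add: poly_mat_of_vec_def coeff_sum)

lemma poly_mat_of_vec_graded: "poly_mat_of_vec a b p q c \<in> graded b p q"
  by (auto simp: graded_iff coeff_poly_mat_of_vec) (simp add: poly_mat_of_vec_def)

lemma triple_index_cases:
  fixes x b p q :: nat
  assumes "x < (b + 1) * p * q"
  obtains e i j where "e \<le> b" "i < p" "j < q" "x = (e * p + i) * q + j"
proof -
  obtain y j where y: "y < (b + 1) * p" "j < q" "x = y * q + j"
    using assms by (rule block_index_cases)
  obtain e i where "e < b + 1" "i < p" "y = e * p + i" using y(1) by (rule block_index_cases)
  then show ?thesis using that[of e i j] y by simp
qed

lemma triple_index_less: "e \<le> b \<Longrightarrow> i < p \<Longrightarrow> j < q \<Longrightarrow> (e * p + i) * q + j < (b + 1) * p * (q::nat)"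
  by (intro block_index_less) auto

lemma linear_poly_mat_of_vec:
  assumes "a + (b + 1) * p * q \<le> k"
  shows "linear_mat k p q (poly_mat_of_vec a b p q :: 'a::field vec \<Rightarrow> 'a poly mat)"
proof -
  have "linear_entry k (\<lambda>c :: 'a vec. poly_mat_of_vec a b p q c $$ (i, j))" if "i < p" "j < q" for i j
  proof (rule linear_entry_cong)
    show "linear_entry k (\<lambda>c :: 'a vec. \<Sum>e\<le>b. monom (c $ (a + ((e * p + i) * q + j))) e)"
      using triple_index_less[of _ b i p j q] that assms
      by (intro linear_entry_sum linear_entry_coord) (meson add_less_cancel_left atMost_iff less_le_trans)
  qed (use that in \<open>simp add: poly_mat_of_vec_def\<close>)
  then show ?thesis unfolding linear_mat_def by (simp add: graded_carrier[OF poly_mat_of_vec_graded])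
qed

lemma poly_mat_of_vec_inj:
  assumes "poly_mat_of_vec a b p q c = poly_mat_of_vec a b p q c'" "x < (b + 1) * p * q"
  shows "c $ (a + x) = c' $ (a + x)"
proof -
  obtain e i j where "e \<le> b" "i < p" "j < q" "x = (e * p + i) * q + j"
    using assms(2) by (rule triple_index_cases)
  then show ?thesis
    using coeff_poly_mat_of_vec[of i p j q a b c e] coeff_poly_mat_of_vec[of i p j q a b c' e] assms(1)
    by simp
qed

lemma poly_mat_of_vec_eqI:
  assumes X: "X \<in> graded b p q"
    and c: "\<And>e i j. e \<le> b \<Longrightarrow> i < p \<Longrightarrow> j < q \<Longrightarrow>
      c $ (a + ((e * p + i) * q + j)) = coeff (X $$ (i, j)) e"
  shows "poly_mat_of_vec a b p q c = X"
proof (rule eq_matI)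
  note Xc = graded_carrier[OF X]
  fix i j assume "i < dim_row X" "j < dim_col X"
  then have ij: "i < p" "j < q" using Xc by auto
  show "poly_mat_of_vec a b p q c $$ (i, j) = X $$ (i, j)"
    by (rule poly_eqI) (use ij c graded_coeff[OF X] in \<open>auto simp: coeff_poly_mat_of_vec\<close>)
qed (use graded_carrier[OF X] in \<open>auto simp: poly_mat_of_vec_def\<close>)

lemma poly_mat_of_vec_surj:
  assumes X: "X \<in> graded b p q" and Y: "Y \<in> graded b' p' q'"
    and k: "k = (b + 1) * p * q + (b' + 1) * p' * q'"
  shows "\<exists>c \<in> carrier_vec k. poly_mat_of_vec 0 b p q c = X \<and>
    poly_mat_of_vec ((b + 1) * p * q) b' p' q' c = Y"
proof -
  \<comment> \<open>The coefficient of \<open>Z\<close> at position \<open>x\<close> of the enumeration.\<close>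
  define h where "h p q Z x = coeff (Z $$ (x div q mod p, x mod q)) (x div q div p)"
    for p q x and Z :: "'a poly mat"
  have h: "h p q Z ((e * p + i) * q + j) = coeff (Z $$ (i, j)) e" if "i < p" "j < q" for p q Z e i j
    using that by (simp add: h_def)
  define s where "s = (b + 1) * p * q"
  define c where "c = vec k (\<lambda>x. if x < s then h p q X x else h p' q' Y (x - s))"
  have "poly_mat_of_vec 0 b p q c = X"
  proof (rule poly_mat_of_vec_eqI[OF X])
    fix e i j assume eij: "e \<le> b" "i < p" "j < q"
    then have "(e * p + i) * q + j < s" unfolding s_def by (rule triple_index_less)
    then show "c $ (0 + ((e * p + i) * q + j)) = coeff (X $$ (i, j)) e"
      using h[OF eij(2,3)] by (simp add: c_def k s_def)
  qed
  moreover have "poly_mat_of_vec s b' p' q' c = Y"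
  proof (rule poly_mat_of_vec_eqI[OF Y])
    fix e i j assume eij: "e \<le> b'" "i < p'" "j < q'"
    then have "(e * p' + i) * q' + j < (b' + 1) * p' * q'" by (rule triple_index_less)
    then show "c $ (s + ((e * p' + i) * q' + j)) = coeff (Y $$ (i, j)) e"
      using h[OF eij(2,3)] by (simp add: c_def k s_def)
  qed
  ultimately show ?thesis unfolding s_def by (intro bexI[of _ c]) (auto simp: c_def)
qed

lemma depends_on_free_parametersI:
  assumes M0: "M0 \<in> carrier_mat p q" and F: "linear_mat k p q F"
    and bij: "bij_betw (\<lambda>c. M0 + F c) (carrier_vec k) S"
  shows "depends_on_free_parameters p q S k"
proof -
  have "\<forall>i<p. \<forall>j<q. \<exists>v. \<forall>c \<in> carrier_vec k. F c $$ (i, j) = (\<Sum>t<k. Polynomial.smult (c $ t) (v t))"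
    using F by (auto simp: linear_mat_def linear_entry_def)
  then obtain v where v: "\<And>i j c. i < p \<Longrightarrow> j < q \<Longrightarrow> c \<in> carrier_vec k \<Longrightarrow>
      F c $$ (i, j) = (\<Sum>t<k. Polynomial.smult (c $ t) (v i j t))" by metis
  define V where "V t = mat p q (\<lambda>(i, j). v i j t)" for t
  have "M0 + F c = mat p q (\<lambda>(i, j). M0 $$ (i, j) + (\<Sum>t<k. Polynomial.smult (c $ t) (V t $$ (i, j))))"
    if "c \<in> carrier_vec k" for c
    using that F M0 v[OF _ _ that] by (intro eq_matI) (auto simp: linear_mat_def V_def)
  then have "bij_betw (\<lambda>c. mat p q (\<lambda>(i, j). M0 $$ (i, j) + (\<Sum>t<k. Polynomial.smult (c $ t) (V t $$ (i, j)))))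
      (carrier_vec k) S"
    using bij by (subst bij_betw_cong[where g = "\<lambda>c. M0 + F c"]) auto
  then show ?thesis
    unfolding depends_on_free_parameters_def
    using M0 by (intro bexI[of _ M0] exI[of _ V]) (auto simp: V_def)
qed

lemma depends_on_free_parameters_infinite:
  assumes S: "depends_on_free_parameters p q (S :: 'a::field poly mat set) k" and k: "0 < k"
    and inf: "infinite (UNIV :: 'a set)"
  shows "infinite S"
proof -
  have "inj (\<lambda>a::'a. vec k (\<lambda>_. a))"
    by (rule injI) (metis k index_vec)
  then have "infinite (range (\<lambda>a::'a. vec k (\<lambda>_. a)))" using inf finite_imageD by blast
  moreover have "range (\<lambda>a::'a. vec k (\<lambda>_. a)) \<subseteq> carrier_vec k" by auto
  ultimately have "infinite (carrier_vec k :: 'a vec set)" using finite_subset by blast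
  moreover obtain f where "bij_betw f (carrier_vec k :: 'a vec set) S"
    using S by (auto simp: depends_on_free_parameters_def)
  ultimately show ?thesis using bij_betw_finite by blast
qed

context dual_pairs
begin

lemma sols_nonempty:
  assumes P: "P \<in> graded (\<eta> + (l + \<epsilon>)) m n"
  shows "sols P \<noteq> {}"
  using sol_in_sols[OF P, of "0\<^sub>m m2 n" "0\<^sub>m m1 (m + m2)"] by (auto simp: graded_iff)

lemma sols_free_parameters:
  assumes P: "P \<in> graded (\<eta> + (l + \<epsilon>)) m n"
  shows "depends_on_free_parameters (m + m2) (n + m1) (sols P) (m2 * n * (\<epsilon> + 1) + (m2 + m) * m1)"
proof -
  define s where "s = (\<epsilon> + 1) * m2 * n"
  define k where "k = s + (0 + 1) * m1 * (m + m2)"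
  define X :: "'a vec \<Rightarrow> 'a poly mat" where "X = poly_mat_of_vec 0 \<epsilon> m2 n"
  define Y :: "'a vec \<Rightarrow> 'a poly mat" where "Y = poly_mat_of_vec s 0 m1 (m + m2)"
  have gX: "X c \<in> graded \<epsilon> m2 n" and gY: "Y c \<in> graded 0 m1 (m + m2)" for c :: "'a vec"
    unfolding X_def Y_def by (rule poly_mat_of_vec_graded)+
  have lX: "linear_mat k m2 n X" and lY: "linear_mat k m1 (m + m2) Y"
    unfolding X_def Y_def by (rule linear_poly_mat_of_vec; simp add: k_def s_def)+
  define M0 where "M0 = (S1 ((S2 P)\<^sup>T))\<^sup>T"
  define F where "F c = (S1 ((X c)\<^sup>T * K2))\<^sup>T + (Y c)\<^sup>T * K1" for c
  have M0: "M0 \<in> carrier_mat (m + m2) (n + m1)"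
    unfolding M0_def by (rule graded_carrier[OF S1_props(1)[OF S2_props(1)[OF P]]])
  have lF: "linear_mat k (m + m2) (n + m1) F"
    unfolding F_def
    by (intro linear_mat_add linear_mat_transpose linear_mat_conv_solve[OF _ G1(1)]
        linear_mat_mult[OF linear_mat_transpose[OF lX] carrier_bases(3)]
        linear_mat_mult[OF linear_mat_transpose[OF lY] carrier_bases(1)])
  have sol_eq: "M0 + F c = sol P (X c) (Y c)" if "c \<in> carrier_vec k" for c
  proof -
    have B: "(S1 ((X c)\<^sup>T * K2))\<^sup>T \<in> carrier_mat (m + m2) (n + m1)"
      using S1_props(1)[OF K2_mult_graded(1)[OF gX[of c]], folded K2_mult_graded(2)[OF gX[of c]]]
      by (rule graded_carrier)
    have C: "(Y c)\<^sup>T * K1 \<in> carrier_mat (m + m2) (n + m1)"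
      using graded_carrier[OF gY[of c]] carrier_bases(1) by simp
    show ?thesis unfolding sol_def F_def M0_def[symmetric] by (rule assoc_add_mat[OF M0 B C, symmetric])
  qed
  have "bij_betw (\<lambda>c. sol P (X c) (Y c)) (carrier_vec k) (sols P)"
  proof (rule bij_betw_imageI)
    show "inj_on (\<lambda>c. sol P (X c) (Y c)) (carrier_vec k)"
    proof (rule inj_onI)
      fix c c' :: "'a vec"
      assume c: "c \<in> carrier_vec k" "c' \<in> carrier_vec k" and eq: "sol P (X c) (Y c) = sol P (X c') (Y c')"
      have XY: "X c = X c'" "Y c = Y c'" using sol_inj[OF P gX gX gY gY eq] by auto
      show "c = c'"
      proof (rule eq_vecI)
        fix x assume "x < dim_vec c'"
        then have x: "x < k" using c by simp
        show "c $ x = c' $ x"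
        proof (cases "x < s")
          case True
          then show ?thesis using poly_mat_of_vec_inj[OF XY(1)[unfolded X_def], of x] by (simp add: s_def)
        next
          case False
          then show ?thesis
            using poly_mat_of_vec_inj[OF XY(2)[unfolded Y_def], of "x - s"] x by (simp add: k_def)
        qed
      qed (use c in simp)
    qed
    show "(\<lambda>c. sol P (X c) (Y c)) ` carrier_vec k = sols P"
    proof (intro equalityI subsetI)
      fix M assume "M \<in> (\<lambda>c. sol P (X c) (Y c)) ` carrier_vec k"
      then show "M \<in> sols P" using sol_in_sols[OF P gX gY] by blast
    next
      fix M assume "M \<in> sols P"
      from sol_surj[OF P this] obtain X' Y'
        where XY: "X' \<in> graded \<epsilon> m2 n" "Y' \<in> graded 0 m1 (m + m2)" "M = sol P X' Y'" by blast
      obtain c where "c \<in> carrier_vec k" "X c = X'" "Y c = Y'"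
        using poly_mat_of_vec_surj[OF XY(1,2) k_def[unfolded s_def]] unfolding X_def Y_def s_def by blast
      then show "M \<in> (\<lambda>c. sol P (X c) (Y c)) ` carrier_vec k" using XY(3) by blast
    qed
  qed
  then have "bij_betw (\<lambda>c. M0 + F c) (carrier_vec k) (sols P)"
    using sol_eq by (subst bij_betw_cong[where g = "\<lambda>c. sol P (X c) (Y c)"]) auto
  from depends_on_free_parametersI[OF M0 lF this]
  have "depends_on_free_parameters (m + m2) (n + m1) (sols P) k" .
  moreover have "k = m2 * n * (\<epsilon> + 1) + (m2 + m) * m1"
    by (simp add: k_def s_def algebra_simps)
  ultimately show ?thesis by simp
qed

text \<open>A solution of grade \<open>l - 1\<close> would make \<open>P\<close> have grade \<open>\<eta> + (l - 1) + \<epsilon>\<close>.\<close>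

lemma sols_degree:
  assumes "0 < l" and d: "mat_deg P = \<eta> + (l + \<epsilon>)" and M: "M \<in> sols P"
  shows "mat_deg M = l"
proof (rule ccontr)
  have gM: "M \<in> graded l (m + m2) (n + m1)" and MP: "N2 * M * N1\<^sup>T = P" using M by auto
  assume "mat_deg M \<noteq> l"
  then have "M \<in> graded (l - 1) (m + m2) (n + m1)" using gM unfolding graded_mat_deg by linarith
  then have "P \<in> graded (\<eta> + (l - 1) + \<epsilon>) m n"
    unfolding MP[symmetric]
    by (intro graded_mult[OF graded_mult[OF graded_bases(4)] graded_transpose[OF graded_bases(2)]])
  then show False using d \<open>0 < l\<close> unfolding graded_mat_deg by linarith
qed

end

section \<open>The theorem\<close>

theorem theorem5p4:
  fixes P K1 N1 K2 N2 :: "'a::field poly mat"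
    and m n m1 m2 d l \<epsilon> \<eta> :: nat
    and \<sigma> :: "'a \<Rightarrow> 'a"
  assumes "P \<in> graded d m n"
    and "0 < l" and "l < d"
    and "dual_minimal_bases m1 n (n + m1) K1 N1"
    and "dual_minimal_bases m2 m (m + m2) K2 N2"
    and "row_degrees_eq K1 l" and "row_degrees_eq K2 l"
    and "row_degrees_eq N1 \<epsilon>" and "row_degrees_eq N2 \<eta>"
    and "\<epsilon> + \<eta> = d - l" and "\<epsilon> \<noteq> 0" and "\<eta> \<noteq> 0"
    and "field_involution \<sigma>"
  defines "Sols \<equiv> {M \<in> graded l (m + m2) (n + m1). N2 * M * N1\<^sup>T = P}"
    and "\<Phi>1 \<equiv> min_norm_sol \<sigma> \<epsilon> l N1"
    and "\<Phi>2 \<equiv> min_norm_sol \<sigma> \<eta> (l + \<epsilon>) N2"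
  defines "\<Psi> \<equiv> transpose_mat \<circ> \<Phi>1 \<circ> transpose_mat \<circ> \<Phi>2"
  shows "(Sols \<noteq> {} \<and> (infinite (UNIV :: 'a set) \<longrightarrow> infinite Sols) \<and>
          (mat_deg P = d \<longrightarrow> (\<forall>M \<in> Sols. mat_deg M = l))) \<and>
         depends_on_free_parameters (m + m2) (n + m1) Sols (m2 * n * (\<epsilon> + 1) + (m2 + m) * m1) \<and>
         ((\<exists>G1. is_mp_inverse \<sigma> (conv_mat \<epsilon> l N1) G1) \<and>
          (\<exists>G2. is_mp_inverse \<sigma> (conv_mat \<eta> (l + \<epsilon>) N2) G2) \<longrightarrow>
          (\<forall>M \<in> Sols. \<exists>Y \<in> carrier_mat m1 (m2 + m). \<exists>X \<in> graded \<epsilon> m2 n.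
             M = \<Psi> P + (\<Phi>1 (X\<^sup>T * K2))\<^sup>T + (const_poly_mat Y)\<^sup>T * K1))"
proof -
  have d: "d = \<eta> + (l + \<epsilon>)" using assms(3,10) by simp
  have P: "P \<in> graded (\<eta> + (l + \<epsilon>)) m n" using assms(1) d by simp
  note dual1 = assms(4) and dual2 = assms(5)
  have pos: "0 < m1" "0 < m2" "0 < m"
    using dual_minimal_basesD[OF dual1] dual_minimal_basesD[OF dual2] by (auto dest: minimal_basisD(2))
  have Nc: "N1 \<in> carrier_mat n (n + m1)" "N2 \<in> carrier_mat m (m + m2)"
    by (rule minimal_basisD(1)[OF dual_minimal_basesD(3)] dual1 dual2)+
  have A1: "conv_mat \<epsilon> l N1 \<in> carrier_mat ((\<epsilon> + l + 1) * n) ((l + 1) * (n + m1))"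
    by (rule conv_mat_carrier[OF Nc(1)])
  have A2: "conv_mat \<eta> (l + \<epsilon>) N2 \<in> carrier_mat ((\<eta> + (l + \<epsilon>) + 1) * m) ((l + \<epsilon> + 1) * (m + m2))"
    by (rule conv_mat_carrier[OF Nc(2)])
  \<comment> \<open>Here \<open>b = l\<close> for \<open>N1\<close> and \<open>b = l + \<epsilon>\<close> for \<open>N2\<close>; both are at least the row degree \<open>l\<close> of the
    dual bases, so generalized inverses are right inverses.\<close>
  have pairs: "dual_pairs K1 N1 K2 N2 m n m1 m2 l \<epsilon> \<eta> G1 G2"
    if "G1 \<in> carrier_mat ((l + 1) * (n + m1)) ((\<epsilon> + l + 1) * n)"
      "conv_mat \<epsilon> l N1 * G1 * conv_mat \<epsilon> l N1 = conv_mat \<epsilon> l N1"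
      "G2 \<in> carrier_mat ((l + \<epsilon> + 1) * (m + m2)) ((\<eta> + (l + \<epsilon>) + 1) * m)"
      "conv_mat \<eta> (l + \<epsilon>) N2 * G2 * conv_mat \<eta> (l + \<epsilon>) N2 = conv_mat \<eta> (l + \<epsilon>) N2" for G1 G2
    using that assms(6-9) dual1 dual2
      conv_mat_right_inverse[OF dual1 assms(6,8) order_refl that(1,2)]
      conv_mat_right_inverse[OF dual2 assms(7,9) le_add1 that(3,4)]
    by (intro dual_pairs.intro)
  obtain G1 where G1: "G1 \<in> carrier_mat ((l + 1) * (n + m1)) ((\<epsilon> + l + 1) * n)"
      "conv_mat \<epsilon> l N1 * G1 * conv_mat \<epsilon> l N1 = conv_mat \<epsilon> l N1"
    using generalized_inverse_exists[OF A1] by blast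
  obtain G2 where G2: "G2 \<in> carrier_mat ((l + \<epsilon> + 1) * (m + m2)) ((\<eta> + (l + \<epsilon>) + 1) * m)"
      "conv_mat \<eta> (l + \<epsilon>) N2 * G2 * conv_mat \<eta> (l + \<epsilon>) N2 = conv_mat \<eta> (l + \<epsilon>) N2"
    using generalized_inverse_exists[OF A2] by blast
  interpret dual_pairs K1 N1 K2 N2 m n m1 m2 l \<epsilon> \<eta> G1 G2 by (rule pairs[OF G1 G2])
  have ne: "Sols \<noteq> {}" unfolding Sols_def by (rule sols_nonempty[OF P])
  have free: "depends_on_free_parameters (m + m2) (n + m1) Sols (m2 * n * (\<epsilon> + 1) + (m2 + m) * m1)"
    unfolding Sols_def by (rule sols_free_parameters[OF P])
  have inf: "infinite Sols" if "infinite (UNIV :: 'a set)"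
    by (rule depends_on_free_parameters_infinite[OF free _ that]) (use pos in simp)
  have degree: "\<forall>M \<in> Sols. mat_deg M = l" if "mat_deg P = d"
    using sols_degree[OF assms(2) that[unfolded d]] unfolding Sols_def by blast
  have rep: "\<exists>Y \<in> carrier_mat m1 (m2 + m). \<exists>X \<in> graded \<epsilon> m2 n.
      M = \<Psi> P + (\<Phi>1 (X\<^sup>T * K2))\<^sup>T + (const_poly_mat Y)\<^sup>T * K1"
    if mp: "is_mp_inverse \<sigma> (conv_mat \<epsilon> l N1) H1" "is_mp_inverse \<sigma> (conv_mat \<eta> (l + \<epsilon>) N2) H2"
      and M: "M \<in> Sols" for M H1 H2
  proof -
    have H1: "mp_inverse \<sigma> (conv_mat \<epsilon> l N1) = H1" and H2: "mp_inverse \<sigma> (conv_mat \<eta> (l + \<epsilon>) N2) = H2"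
      by (rule mp_inverse_eq[OF assms(13)] mp)+
    have H1c: "H1 \<in> carrier_mat ((l + 1) * (n + m1)) ((\<epsilon> + l + 1) * n)"
      using mp(1) unfolding is_mp_inverse_def carrier_matD[OF A1] by blast
    have H2c: "H2 \<in> carrier_mat ((l + \<epsilon> + 1) * (m + m2)) ((\<eta> + (l + \<epsilon>) + 1) * m)"
      using mp(2) unfolding is_mp_inverse_def carrier_matD[OF A2] by blast
    interpret mp: dual_pairs K1 N1 K2 N2 m n m1 m2 l \<epsilon> \<eta> H1 H2
      using mp by (intro pairs H1c H2c) (auto simp: is_mp_inverse_def)
    obtain X Y where X: "X \<in> graded \<epsilon> m2 n" and Y: "Y \<in> graded 0 m1 (m + m2)"
        and MXY: "M = mp.sol P X Y"
      using mp.sol_surj[OF P M[unfolded Sols_def]] by blast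
    have \<Phi>2P: "\<Phi>2 P = mp.S2 P"
      unfolding \<Phi>2_def using min_norm_sol_eq_conv_solve[where \<nu> = \<eta> and b = "l + \<epsilon>" and \<sigma> = \<sigma>,
          OF Nc(2) graded_carrier[OF P], unfolded H2, OF H2c] .
    have \<Phi>1: "\<Phi>1 R = mp.S1 R" if "R \<in> carrier_mat n (m + m2)" for R
      unfolding \<Phi>1_def using min_norm_sol_eq_conv_solve[where \<nu> = \<epsilon> and b = l and \<sigma> = \<sigma>,
          OF Nc(1) that, unfolded H1, OF H1c] .
    have "(mp.S2 P)\<^sup>T \<in> carrier_mat n (m + m2)"
      using graded_carrier[OF mp.S2_props(1)[OF P]] by simp
    then have \<Psi>P: "\<Psi> P = (mp.S1 ((mp.S2 P)\<^sup>T))\<^sup>T" by (simp add: \<Psi>_def \<Phi>2P \<Phi>1)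
    have "X\<^sup>T * K2 \<in> carrier_mat n (m + m2)"
      using graded_carrier[OF X] carrier_bases(3) by simp
    then have \<Phi>1X: "\<Phi>1 (X\<^sup>T * K2) = mp.S1 (X\<^sup>T * K2)" by (rule \<Phi>1)
    have const: "const_poly_mat (coeff_mat Y 0) = Y"
    proof (rule eq_matI)
      fix i j assume ij: "i < dim_row Y" "j < dim_col Y"
      show "const_poly_mat (coeff_mat Y 0) $$ (i, j) = Y $$ (i, j)"
      proof (rule poly_eqI)
        fix e
        show "coeff (const_poly_mat (coeff_mat Y 0) $$ (i, j)) e = coeff (Y $$ (i, j)) e"
          using ij graded_coeff[OF Y, of i j e] graded_carrier[OF Y]
          by (cases e) (auto simp: const_poly_mat_def coeff_mat_def)
      qed
    qed (auto simp: const_poly_mat_def coeff_mat_def)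
    have "coeff_mat Y 0 \<in> carrier_mat m1 (m2 + m)"
      using graded_carrier[OF Y] by (auto simp: coeff_mat_def)
    moreover have "M = \<Psi> P + (\<Phi>1 (X\<^sup>T * K2))\<^sup>T + (const_poly_mat (coeff_mat Y 0))\<^sup>T * K1"
      unfolding MXY mp.sol_def \<Psi>P \<Phi>1X const ..
    ultimately show ?thesis using X by blast
  qed
  show ?thesis using ne free inf degree rep by blast
qed

end
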